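(* Let $(C,\Delta,P)$ be an idempotent noncounitary Rota-Baxter coalgebra of weight $-1$. Then there exists an idempotent Rota-Baxter coalgebra $(\widetilde{C},\widetilde{\Delta},\varepsilon,\widetilde{P})$ of weight $-1$ such that $C=\ker\varepsilon$ as a subspace and the restriction of $\widetilde{P}$ to $C$ is $P$.
   Context: $\mathbb{K}$ is a fixed ground field of characteristic 0; all vector spaces, coalgebras and tensor products are over $\mathbb{K}$. A Rota-Baxter coalgebra of weight $\lambda\in\mathbb{K}$ is a (coassociative, counital) coalgebra $(C,\Delta,\varepsilon)$ equipped with a linear operator $P:C\to C$ such that $(P\otimes P)\Delta=(\mathrm{id}\otimes P)\Delta P+(P\otimes\mathrm{id})\Delta P+\lambda\Delta P$. A noncounitary Rota-Baxter coalgebra $(C,\Delta,P)$ of weight $\lambda$ is the same with $(C,\Delta)$ a noncounitary coalgebra, i.e. $\Delta$ is coassociative but no counit is required. Either is called idempotent if $P^2=P$. *)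

theory Defs
  imports "Jordan_Normal_Form.Missing_VectorSpace" "HOL-Algebra.AbelCoset"
begin

text \<open>
  Vector spaces over a field \<open>K\<close> are the module records of HOL-Algebra (\<open>vectorspace\<close>,
  \<open>linear_map\<close>). In all module records built below, the ring multiplication and unit that the
  record type carries along are irrelevant and left undefined.
\<close>

definition ground_space :: "('k, 'r) ring_scheme \<Rightarrow> ('k, 'k) module" where
  "ground_space K =
     \<lparr>carrier = carrier K, mult = undefined, one = undefined,
      zero = \<zero>\<^bsub>K\<^esub>, add = add K, smult = mult K\<rparr>"

definition free_space :: "('k, 'r) ring_scheme \<Rightarrow> 'b set \<Rightarrow> ('k, 'b \<Rightarrow> 'k) module" where
  "free_space K X =
     \<lparr>carrier = {f. (\<forall>x\<in>X. f x \<in> carrier K) \<and> (\<forall>x. x \<notin> X \<longrightarrow> f x = \<zero>\<^bsub>K\<^esub>) \<and> finite {x. f x \<noteq> \<zero>\<^bsub>K\<^esub>}},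
      mult = undefined, one = undefined,
      zero = (\<lambda>x. \<zero>\<^bsub>K\<^esub>),
      add = (\<lambda>f g x. f x \<oplus>\<^bsub>K\<^esub> g x),
      smult = (\<lambda>k f x. k \<otimes>\<^bsub>K\<^esub> f x)\<rparr>"

definition free_gen :: "('k, 'r) ring_scheme \<Rightarrow> 'b \<Rightarrow> 'b \<Rightarrow> 'k" where
  "free_gen K x = (\<lambda>y. if y = x then \<one>\<^bsub>K\<^esub> else \<zero>\<^bsub>K\<^esub>)"

definition quotient_space :: "('k, 'v) module \<Rightarrow> 'v set \<Rightarrow> ('k, 'v set) module" where
  "quotient_space V N =
     \<lparr>carrier = a_rcosets\<^bsub>V\<^esub> N, mult = undefined, one = undefined,
      zero = N, add = set_add V,
      smult = (\<lambda>k A. \<Union>v\<in>A. N +>\<^bsub>V\<^esub> (k \<odot>\<^bsub>V\<^esub> v))\<rparr>"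

text \<open>The tensor product is the free space on pairs modulo the bilinearity relations.\<close>

definition bilinearity_relators ::
  "('k, 'r) ring_scheme \<Rightarrow> ('k, 'v) module \<Rightarrow> ('k, 'w) module \<Rightarrow> ('v \<times> 'w \<Rightarrow> 'k) set" where
  "bilinearity_relators K V W =
    (let F = free_space K (carrier V \<times> carrier W); e = free_gen K in
      {e (v \<oplus>\<^bsub>V\<^esub> v', w) \<ominus>\<^bsub>F\<^esub> (e (v, w) \<oplus>\<^bsub>F\<^esub> e (v', w)) | v v' w.
         v \<in> carrier V \<and> v' \<in> carrier V \<and> w \<in> carrier W} \<union>
      {e (v, w \<oplus>\<^bsub>W\<^esub> w') \<ominus>\<^bsub>F\<^esub> (e (v, w) \<oplus>\<^bsub>F\<^esub> e (v, w')) | v w w'.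
         v \<in> carrier V \<and> w \<in> carrier W \<and> w' \<in> carrier W} \<union>
      {e (k \<odot>\<^bsub>V\<^esub> v, w) \<ominus>\<^bsub>F\<^esub> (k \<odot>\<^bsub>F\<^esub> e (v, w)) | k v w.
         k \<in> carrier K \<and> v \<in> carrier V \<and> w \<in> carrier W} \<union>
      {e (v, k \<odot>\<^bsub>W\<^esub> w) \<ominus>\<^bsub>F\<^esub> (k \<odot>\<^bsub>F\<^esub> e (v, w)) | k v w.
         k \<in> carrier K \<and> v \<in> carrier V \<and> w \<in> carrier W})"

definition tensor_null ::
  "('k, 'r) ring_scheme \<Rightarrow> ('k, 'v) module \<Rightarrow> ('k, 'w) module \<Rightarrow> ('v \<times> 'w \<Rightarrow> 'k) set" where
  "tensor_null K V W =
     module.span K (free_space K (carrier V \<times> carrier W)) (bilinearity_relators K V W)"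

definition tensor ::
  "('k, 'r) ring_scheme \<Rightarrow> ('k, 'v) module \<Rightarrow> ('k, 'w) module \<Rightarrow> ('k, ('v \<times> 'w \<Rightarrow> 'k) set) module" where
  "tensor K V W = quotient_space (free_space K (carrier V \<times> carrier W)) (tensor_null K V W)"

definition pure_tensor ::
  "('k, 'r) ring_scheme \<Rightarrow> ('k, 'v) module \<Rightarrow> ('k, 'w) module \<Rightarrow> 'v \<Rightarrow> 'w \<Rightarrow> ('v \<times> 'w \<Rightarrow> 'k) set" where
  "pure_tensor K V W v w =
     tensor_null K V W +>\<^bsub>free_space K (carrier V \<times> carrier W)\<^esub> free_gen K (v, w)"

text \<open>
  For bilinear \<open>b\<close> from \<open>V\<close> and \<open>W\<close> to \<open>U\<close>, \<open>tensor_lift K U b\<close> is the linear map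
  \<open>V \<otimes> W \<rightarrow> U\<close> with \<open>v \<otimes> w \<mapsto> b v w\<close>: it evaluates \<open>b\<close> on a representative of the coset,
  and the choice of the representative does not matter.
\<close>

definition tensor_lift ::
  "('k, 'r) ring_scheme \<Rightarrow> ('k, 'u) module \<Rightarrow> ('v \<Rightarrow> 'w \<Rightarrow> 'u) \<Rightarrow> ('v \<times> 'w \<Rightarrow> 'k) set \<Rightarrow> 'u" where
  "tensor_lift K U b t =
    (let r = (SOME r. r \<in> t) in
      \<Oplus>\<^bsub>U\<^esub>z\<in>{z. r z \<noteq> \<zero>\<^bsub>K\<^esub>}. r z \<odot>\<^bsub>U\<^esub> b (fst z) (snd z))"

text \<open>\<open>tensor_map K V' W' f g\<close> is \<open>f \<otimes> g\<close>, where \<open>V'\<close> and \<open>W'\<close> are the codomains of \<open>f\<close> and \<open>g\<close>.\<close>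

definition tensor_map ::
  "('k, 'r) ring_scheme \<Rightarrow> ('k, 'x) module \<Rightarrow> ('k, 'y) module \<Rightarrow> ('v \<Rightarrow> 'x) \<Rightarrow> ('w \<Rightarrow> 'y) \<Rightarrow>
     ('v \<times> 'w \<Rightarrow> 'k) set \<Rightarrow> ('x \<times> 'y \<Rightarrow> 'k) set" where
  "tensor_map K V' W' f g =
     tensor_lift K (tensor K V' W') (\<lambda>v w. pure_tensor K V' W' (f v) (g w))"

text \<open>The associativity isomorphism \<open>(U \<otimes> V) \<otimes> W \<rightarrow> U \<otimes> (V \<otimes> W)\<close>.\<close>

definition tensor_assoc ::
  "('k, 'r) ring_scheme \<Rightarrow> ('k, 'u) module \<Rightarrow> ('k, 'v) module \<Rightarrow> ('k, 'w) module \<Rightarrow>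
     (('u \<times> 'v \<Rightarrow> 'k) set \<times> 'w \<Rightarrow> 'k) set \<Rightarrow> ('u \<times> ('v \<times> 'w \<Rightarrow> 'k) set \<Rightarrow> 'k) set" where
  "tensor_assoc K U V W =
     tensor_lift K (tensor K U (tensor K V W))
       (\<lambda>t w. tensor_lift K (tensor K U (tensor K V W))
          (\<lambda>u v. pure_tensor K U (tensor K V W) u (pure_tensor K V W v w)) t)"

locale noncounitary_coalgebra =
  fixes K :: "('k, 'r) ring_scheme"
    and C :: "('k, 'c) module"
    and \<Delta> :: "'c \<Rightarrow> ('c \<times> 'c \<Rightarrow> 'k) set"
  assumes comult_linear: "linear_map K C (tensor K C C) \<Delta>"
    and coassoc: "c \<in> carrier C \<Longrightarrow>
      tensor_assoc K C C C (tensor_map K (tensor K C C) C \<Delta> id (\<Delta> c)) =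
      tensor_map K C (tensor K C C) id \<Delta> (\<Delta> c)"

text \<open>
  The counit laws are stated in \<open>K \<otimes> C\<close> and \<open>C \<otimes> K\<close>, where \<open>\<one> \<otimes> c\<close> and \<open>c \<otimes> \<one>\<close> are the
  elements corresponding to \<open>c\<close> under the canonical isomorphisms with \<open>C\<close>.
\<close>

locale counitary_coalgebra = noncounitary_coalgebra K C \<Delta>
  for K :: "('k, 'r) ring_scheme"
    and C :: "('k, 'c) module"
    and \<Delta> :: "'c \<Rightarrow> ('c \<times> 'c \<Rightarrow> 'k) set" +
  fixes \<epsilon> :: "'c \<Rightarrow> 'k"
  assumes counit_linear: "linear_map K C (ground_space K) \<epsilon>"
    and counit_left: "c \<in> carrier C \<Longrightarrow>
      tensor_map K (ground_space K) C \<epsilon> id (\<Delta> c) = pure_tensor K (ground_space K) C \<one>\<^bsub>K\<^esub> c"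
    and counit_right: "c \<in> carrier C \<Longrightarrow>
      tensor_map K C (ground_space K) id \<epsilon> (\<Delta> c) = pure_tensor K C (ground_space K) c \<one>\<^bsub>K\<^esub>"

locale rota_baxter_operator =
  fixes K :: "('k, 'r) ring_scheme"
    and C :: "('k, 'c) module"
    and \<Delta> :: "'c \<Rightarrow> ('c \<times> 'c \<Rightarrow> 'k) set"
    and P :: "'c \<Rightarrow> 'c"
    and weight :: 'k
  assumes weight_closed: "weight \<in> carrier K"
    and operator_linear: "linear_map K C C P"
    and rota_baxter: "c \<in> carrier C \<Longrightarrow>
      tensor_map K C C P P (\<Delta> c) =
        tensor_map K C C id P (\<Delta> (P c))
        \<oplus>\<^bsub>tensor K C C\<^esub> tensor_map K C C P id (\<Delta> (P c))
        \<oplus>\<^bsub>tensor K C C\<^esub> (weight \<odot>\<^bsub>tensor K C C\<^esub> \<Delta> (P c))"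

locale noncounitary_rota_baxter_coalgebra =
  noncounitary_coalgebra K C \<Delta> + rota_baxter_operator K C \<Delta> P weight
  for K :: "('k, 'r) ring_scheme"
    and C :: "('k, 'c) module"
    and \<Delta> :: "'c \<Rightarrow> ('c \<times> 'c \<Rightarrow> 'k) set"
    and P :: "'c \<Rightarrow> 'c"
    and weight :: 'k

locale rota_baxter_coalgebra =
  counitary_coalgebra K C \<Delta> \<epsilon> + rota_baxter_operator K C \<Delta> P weight
  for K :: "('k, 'r) ring_scheme"
    and C :: "('k, 'c) module"
    and \<Delta> :: "'c \<Rightarrow> ('c \<times> 'c \<Rightarrow> 'k) set"
    and \<epsilon> :: "'c \<Rightarrow> 'k"
    and P :: "'c \<Rightarrow> 'c"
    and weight :: 'k

definition idempotent_operator :: "('k, 'c) module \<Rightarrow> ('c \<Rightarrow> 'c) \<Rightarrow> bool" where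
  "idempotent_operator C P \<longleftrightarrow> (\<forall>c\<in>carrier C. P (P c) = P c)"

definition char_zero :: "('k, 'r) ring_scheme \<Rightarrow> bool" where
  "char_zero K \<longleftrightarrow> (\<forall>n::nat. n > 0 \<longrightarrow> [n] \<cdot>\<^bsub>K\<^esub> \<one>\<^bsub>K\<^esub> \<noteq> \<zero>\<^bsub>K\<^esub>)"

end

theory Submission
  imports Defs
begin

text \<open>
  Adjoin a group-like element \<open>\<e>\<close>: on \<open>K \<oplus> C\<close> put \<open>\<Delta>' \<e> = \<e> \<otimes> \<e>\<close> and
  \<open>\<Delta>' c = \<Delta> c + \<e> \<otimes> c + c \<otimes> \<e>\<close> for \<open>c \<in> C\<close>, let \<open>\<epsilon>\<close> be the projection to \<open>K\<close>, and
  extend \<open>P\<close> by \<open>P' \<e> = \<e>\<close>. In the Rota-Baxter identity at \<open>c\<close> the terms involving \<open>\<e>\<close>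
  are \<open>\<e> \<otimes> P c + P c \<otimes> \<e>\<close> on the left, and on the right \<open>\<e> \<otimes> P (P c) + P c \<otimes> \<e>\<close> plus
  \<open>\<e> \<otimes> P c + P (P c) \<otimes> \<e>\<close> minus \<open>\<e> \<otimes> P c + P c \<otimes> \<e>\<close>; they agree because \<open>P\<close> is
  idempotent.
\<close>

section \<open>Linear maps\<close>

text \<open>The cross terms in \<open>\<Delta>'\<close> make \<epsilon> a counit: applying
  \<epsilon> to one factor kills every summand of \<open>\<Delta>' c\<close> except the one with
  \<e> in that factor. The value of \<open>P'\<close> at \<e> is nearly forced: if
  \<open>P' \<e>\<close> is \<mu> times \<e>, the Rota-Baxter identity at \<e> reads \<mu>^2 = 2
  \<mu>^2 - \<mu>, so \<mu> is 0 or 1, and 1 is taken here. In the coassociativity of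
  \<open>\<Delta>'\<close>, the elements \<e> \<otimes> \<Delta> c and \<Delta> c \<otimes> \<e>
  arise on the two sides from different summands of \<open>\<Delta>' c\<close>, so the sides agree
  only after regrouping. The obstacle is that tensors are cosets of finitely supported functions and
  lifts choose a representative, so identities cannot be computed directly. They are reduced to
  generators instead: linear maps out of a tensor product are compared on pure tensors, and linear
  maps out of K \<oplus> C at \<e> and on C. Moreover C \<otimes> C is not literally contained in
  the larger tensor square, so each identity known for \<Delta> is transported along the tensor
  square of the embedding.\<close>

lemma module_homI:
  assumes "\<And>x. x \<in> carrier M \<Longrightarrow> f x \<in> carrier N"
    and "\<And>x y. x \<in> carrier M \<Longrightarrow> y \<in> carrier M \<Longrightarrow> f (x \<oplus>\<^bsub>M\<^esub> y) = f x \<oplus>\<^bsub>N\<^esub> f y"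
    and "\<And>r x. r \<in> carrier R \<Longrightarrow> x \<in> carrier M \<Longrightarrow> f (r \<odot>\<^bsub>M\<^esub> x) = r \<odot>\<^bsub>N\<^esub> f x"
  shows "f \<in> module_hom R M N"
  using assms by (auto simp: module_hom_def)

lemma module_hom_mem: "f \<in> module_hom R M N \<Longrightarrow> x \<in> carrier M \<Longrightarrow> f x \<in> carrier N"
  by (auto simp: module_hom_def)

lemma mod_homI: "module R M \<Longrightarrow> module R N \<Longrightarrow> f \<in> module_hom R M N \<Longrightarrow> mod_hom R M N f"
  by (simp add: mod_hom_def mod_hom_axioms_def)

lemma module_hom_zero:
  assumes "module R M" "module R N" "f \<in> module_hom R M N"
  shows "f \<zero>\<^bsub>M\<^esub> = \<zero>\<^bsub>N\<^esub>"
  using mod_hom.f0_is_0[OF mod_homI[OF assms]] .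

lemma module_hom_id: "id \<in> module_hom R M M"
  by (simp add: module_hom_def)

lemma module_hom_comp:
  assumes "f \<in> module_hom R M N" "g \<in> module_hom R N L"
  shows "(\<lambda>x. g (f x)) \<in> module_hom R M L"
  using assms by (auto simp: module_hom_def Pi_iff)

lemma module_hom_sum:
  assumes "module R N" "f \<in> module_hom R M N" "g \<in> module_hom R M N"
  shows "(\<lambda>x. f x \<oplus>\<^bsub>N\<^esub> g x) \<in> module_hom R M N"
proof -
  interpret N: module R N by fact
  show ?thesis
    using assms(2,3)
    by (intro module_homI)
      (simp_all add: module_hom_mem module_hom_add module_hom_smult N.a_ac N.smult_r_distr)
qed

text \<open>Commutativity of the ground ring lets the fixed scalar pass the variable one.\<close>

lemma module_hom_scale:
  assumes "module R N" "k \<in> carrier R" "f \<in> module_hom R M N"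
  shows "(\<lambda>x. k \<odot>\<^bsub>N\<^esub> f x) \<in> module_hom R M N"
proof -
  interpret N: module R N by fact
  show ?thesis
    using assms(2,3)
    by (intro module_homI)
      (simp_all add: module_hom_mem module_hom_add module_hom_smult N.smult_r_distr
        N.m_comm flip: N.smult_assoc1)
qed

lemma module_hom_zero_map:
  assumes "module R N"
  shows "(\<lambda>x. \<zero>\<^bsub>N\<^esub>) \<in> module_hom R M N"
proof -
  interpret N: module R N by fact
  show ?thesis by (simp add: module_hom_def)
qed

text \<open>Bilinearity is encoded as two families of homomorphisms, so that it is inherited under
  composition directly from \<open>module_hom_comp\<close>.\<close>

definition bilinear_on where
  "bilinear_on K V W U b \<longleftrightarrow>
     (\<forall>v\<in>carrier V. b v \<in> module_hom K W U) \<and>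
     (\<forall>w\<in>carrier W. (\<lambda>v. b v w) \<in> module_hom K V U)"

lemma bilinear_on_left: "bilinear_on K V W U b \<Longrightarrow> w \<in> carrier W \<Longrightarrow> (\<lambda>v. b v w) \<in> module_hom K V U"
  by (simp add: bilinear_on_def)

lemma bilinear_on_right: "bilinear_on K V W U b \<Longrightarrow> v \<in> carrier V \<Longrightarrow> b v \<in> module_hom K W U"
  by (simp add: bilinear_on_def)

lemma bilinear_on_precomp:
  assumes "bilinear_on K V W U b" "f \<in> module_hom K V' V" "g \<in> module_hom K W' W"
  shows "bilinear_on K V' W' U (\<lambda>v w. b (f v) (g w))"
  unfolding bilinear_on_def
proof (intro conjI ballI)
  fix v assume "v \<in> carrier V'"
  then show "(\<lambda>w. b (f v) (g w)) \<in> module_hom K W' U"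
    by (intro module_hom_comp[OF assms(3)] bilinear_on_right[OF assms(1)] module_hom_mem[OF assms(2)])
next
  fix w assume "w \<in> carrier W'"
  then show "(\<lambda>v. b (f v) (g w)) \<in> module_hom K V' U"
    by (intro module_hom_comp[OF assms(2), where g = "\<lambda>v. b v (g w)"]
        bilinear_on_left[OF assms(1)] module_hom_mem[OF assms(3)])
qed

section \<open>Free spaces\<close>

lemma free_space_simps [simp]:
  "zero (free_space K X) = (\<lambda>x. \<zero>\<^bsub>K\<^esub>)"
  "f \<oplus>\<^bsub>free_space K X\<^esub> g = (\<lambda>x. f x \<oplus>\<^bsub>K\<^esub> g x)"
  "k \<odot>\<^bsub>free_space K X\<^esub> f = (\<lambda>x. k \<otimes>\<^bsub>K\<^esub> f x)"
  by (simp_all add: free_space_def)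

lemma mem_free_space:
  "f \<in> carrier (free_space K X) \<longleftrightarrow>
     (\<forall>x\<in>X. f x \<in> carrier K) \<and> (\<forall>x. x \<notin> X \<longrightarrow> f x = \<zero>\<^bsub>K\<^esub>) \<and> finite {x. f x \<noteq> \<zero>\<^bsub>K\<^esub>}"
  by (simp add: free_space_def)

context cring
begin

lemma free_space_coeff: "f \<in> carrier (free_space R X) \<Longrightarrow> f x \<in> carrier R"
  by (cases "x \<in> X") (auto simp: mem_free_space)

lemma free_space_add_closed:
  assumes "f \<in> carrier (free_space R X)" "g \<in> carrier (free_space R X)"
  shows "(\<lambda>x. f x \<oplus> g x) \<in> carrier (free_space R X)"
proof -
  have "{x. f x \<oplus> g x \<noteq> \<zero>} \<subseteq> {x. f x \<noteq> \<zero>} \<union> {x. g x \<noteq> \<zero>}"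
    by auto
  then have "finite {x. f x \<oplus> g x \<noteq> \<zero>}"
    by (rule finite_subset) (use assms in \<open>simp add: mem_free_space\<close>)
  with assms show ?thesis
    by (simp add: mem_free_space)
qed

lemma free_space_smult_closed:
  assumes "k \<in> carrier R" "f \<in> carrier (free_space R X)"
  shows "(\<lambda>x. k \<otimes> f x) \<in> carrier (free_space R X)"
proof -
  have "{x. k \<otimes> f x \<noteq> \<zero>} \<subseteq> {x. f x \<noteq> \<zero>}"
    using assms by auto
  then have "finite {x. k \<otimes> f x \<noteq> \<zero>}"
    by (rule finite_subset) (use assms in \<open>simp add: mem_free_space\<close>)
  with assms show ?thesis
    by (simp add: mem_free_space)
qed

lemma free_space_abelian_group: "abelian_group (free_space R X)"
proof (rule abelian_groupI)
  fix f g h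
  assume "f \<in> carrier (free_space R X)" "g \<in> carrier (free_space R X)"
    "h \<in> carrier (free_space R X)"
  note this[THEN free_space_coeff]
  then show "f \<oplus>\<^bsub>free_space R X\<^esub> g \<oplus>\<^bsub>free_space R X\<^esub> h =
      f \<oplus>\<^bsub>free_space R X\<^esub> (g \<oplus>\<^bsub>free_space R X\<^esub> h)"
    by (simp add: a_assoc)
next
  fix f g
  assume fg: "f \<in> carrier (free_space R X)" "g \<in> carrier (free_space R X)"
  note fg[THEN free_space_coeff]
  then show "f \<oplus>\<^bsub>free_space R X\<^esub> g = g \<oplus>\<^bsub>free_space R X\<^esub> f"
    by (simp add: a_comm)
  from fg show "f \<oplus>\<^bsub>free_space R X\<^esub> g \<in> carrier (free_space R X)"
    by (simp add: free_space_add_closed)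
next
  fix f
  assume f: "f \<in> carrier (free_space R X)"
  note coeff = free_space_coeff[OF f]
  then show "\<zero>\<^bsub>free_space R X\<^esub> \<oplus>\<^bsub>free_space R X\<^esub> f = f"
    by simp
  \<comment> \<open>The negative is written as a multiple by minus one, so that its membership
    follows from closure under scalars.\<close>
  have "(\<lambda>x. \<ominus> \<one> \<otimes> f x) \<oplus>\<^bsub>free_space R X\<^esub> f = \<zero>\<^bsub>free_space R X\<^esub>"
    using coeff by (simp add: l_minus l_neg)
  then show "\<exists>g\<in>carrier (free_space R X). g \<oplus>\<^bsub>free_space R X\<^esub> f = \<zero>\<^bsub>free_space R X\<^esub>"
    using free_space_smult_closed[OF _ f, of "\<ominus> \<one>"] by blast
qed (simp add: mem_free_space)

lemma free_space_module: "module R (free_space R X)"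
proof (rule moduleI[OF is_cring free_space_abelian_group])
  fix a f
  assume a: "a \<in> carrier R" and f: "f \<in> carrier (free_space R X)"
  then show "a \<odot>\<^bsub>free_space R X\<^esub> f \<in> carrier (free_space R X)"
    by (simp add: free_space_smult_closed)
  note coeff = free_space_coeff[OF f]
  fix b assume "b \<in> carrier R"
  with a coeff show "(a \<oplus> b) \<odot>\<^bsub>free_space R X\<^esub> f =
      a \<odot>\<^bsub>free_space R X\<^esub> f \<oplus>\<^bsub>free_space R X\<^esub> b \<odot>\<^bsub>free_space R X\<^esub> f"
    and "(a \<otimes> b) \<odot>\<^bsub>free_space R X\<^esub> f = a \<odot>\<^bsub>free_space R X\<^esub> (b \<odot>\<^bsub>free_space R X\<^esub> f)"
    by (simp_all add: l_distr m_assoc)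
next
  fix f
  assume "f \<in> carrier (free_space R X)"
  from free_space_coeff[OF this] show "\<one> \<odot>\<^bsub>free_space R X\<^esub> f = f"
    by simp
next
  fix a f g
  assume a: "a \<in> carrier R" and fg: "f \<in> carrier (free_space R X)" "g \<in> carrier (free_space R X)"
  note fg[THEN free_space_coeff]
  with a show "a \<odot>\<^bsub>free_space R X\<^esub> (f \<oplus>\<^bsub>free_space R X\<^esub> g) =
      a \<odot>\<^bsub>free_space R X\<^esub> f \<oplus>\<^bsub>free_space R X\<^esub> a \<odot>\<^bsub>free_space R X\<^esub> g"
    by (simp add: r_distr)
qed

lemma free_gen_closed: "x \<in> X \<Longrightarrow> free_gen R x \<in> carrier (free_space R X)"
  by (simp add: mem_free_space free_gen_def)

text \<open>One point of the support is removed at a time. The induction runs over a finite superset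
  \<open>S\<close> of the support, so a point of \<open>S\<close> may lie outside \<open>X\<close>;
  there the function is already zero and removing the point changes nothing.\<close>

lemma free_space_induct [consumes 1, case_names zero step]:
  assumes f: "f \<in> carrier (free_space R X)"
    and zero: "Q (\<lambda>x. \<zero>)"
    and step: "\<And>k x g. \<lbrakk>k \<in> carrier R; x \<in> X; g \<in> carrier (free_space R X); Q g\<rbrakk> \<Longrightarrow>
                 Q (\<lambda>y. k \<otimes> free_gen R x y \<oplus> g y)"
  shows "Q f"
proof -
  have "Q f" if "finite S" "{x. f x \<noteq> \<zero>} \<subseteq> S" "f \<in> carrier (free_space R X)" for S f
    using that
  proof (induction S arbitrary: f)
    case empty
    then have "f = (\<lambda>x. \<zero>)" by auto
    with zero show ?case by simp
  next
    case (insert x S)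
    define g where "g = f(x := \<zero>)"
    have "{y. g y \<noteq> \<zero>} \<subseteq> {y. f y \<noteq> \<zero>}"
      by (auto simp: g_def)
    then have g: "g \<in> carrier (free_space R X)"
      using insert.prems(2) by (auto simp: mem_free_space g_def intro: finite_subset)
    have "Q g"
      using insert.prems by (intro insert.IH g) (auto simp: g_def)
    show ?case
    proof (cases "x \<in> X")
      case True
      have f_eq: "f = (\<lambda>y. f x \<otimes> free_gen R x y \<oplus> g y)"
        using free_space_coeff[OF insert.prems(2)] by (auto simp: g_def free_gen_def)
      show ?thesis
        using step[OF free_space_coeff[OF insert.prems(2), of x] True g \<open>Q g\<close>]
        unfolding f_eq[symmetric] .
    next
      case False
      then have "f = g" using insert.prems(2) by (auto simp: g_def mem_free_space)
      with \<open>Q g\<close> show ?thesis by simp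
    qed
  qed
  with f show ?thesis by (auto simp: mem_free_space)
qed

end

text \<open>Linear extension from the generators. The sum is literally the one in the body of
  \<open>tensor_lift\<close>, which is therefore \<open>free_lift\<close> evaluated at a chosen
  representative.\<close>

definition free_lift where
  "free_lift K U b r = (\<Oplus>\<^bsub>U\<^esub>z\<in>{z. r z \<noteq> \<zero>\<^bsub>K\<^esub>}. r z \<odot>\<^bsub>U\<^esub> b z)"

context module
begin

text \<open>The support of a sum or a multiple can shrink through cancellation. Linearity is
  therefore proved with all sums taken over one common finite index set, the extra terms being
  zero.\<close>

lemma free_lift_superset:
  assumes "r \<in> carrier (free_space R X)" "b \<in> X \<rightarrow> carrier M" "finite A"
    and "{z. r z \<noteq> \<zero>} \<subseteq> A" "A \<subseteq> X"
  shows "free_lift R M b r = (\<Oplus>\<^bsub>M\<^esub>z\<in>A. r z \<odot>\<^bsub>M\<^esub> b z)"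
  unfolding free_lift_def
  using assms free_space_coeff[OF assms(1)]
  by (intro M.add.finprod_mono_neutral_cong_left) (auto simp: Pi_iff)

lemma free_lift_hom:
  assumes b: "b \<in> X \<rightarrow> carrier M"
  shows "free_lift R M b \<in> module_hom R (free_space R X) M"
proof (rule module_homI)
  show "free_lift R M b r \<in> carrier M" if "r \<in> carrier (free_space R X)" for r
    unfolding free_lift_def using b that free_space_coeff[OF that]
    by (intro M.finsum_closed) (auto simp: mem_free_space)
next
  fix r s assume r: "r \<in> carrier (free_space R X)" and s: "s \<in> carrier (free_space R X)"
  let ?A = "{z. r z \<noteq> \<zero>} \<union> {z. s z \<noteq> \<zero>}"
  have A: "finite ?A" "?A \<subseteq> X" "b \<in> ?A \<rightarrow> carrier M"
    using r s b by (auto simp: mem_free_space)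
  note coeff = free_space_coeff[OF r] free_space_coeff[OF s]
  have "free_lift R M b (r \<oplus>\<^bsub>free_space R X\<^esub> s) = (\<Oplus>\<^bsub>M\<^esub>z\<in>?A. (r z \<oplus> s z) \<odot>\<^bsub>M\<^esub> b z)"
    using A r s b by (subst free_lift_superset[of _ X, where A = ?A])
      (auto simp: free_space_add_closed)
  also have "\<dots> = (\<Oplus>\<^bsub>M\<^esub>z\<in>?A. r z \<odot>\<^bsub>M\<^esub> b z \<oplus>\<^bsub>M\<^esub> s z \<odot>\<^bsub>M\<^esub> b z)"
    using A coeff by (intro M.add.finprod_cong') (auto simp: smult_l_distr Pi_iff)
  also have "\<dots> = (\<Oplus>\<^bsub>M\<^esub>z\<in>?A. r z \<odot>\<^bsub>M\<^esub> b z) \<oplus>\<^bsub>M\<^esub> (\<Oplus>\<^bsub>M\<^esub>z\<in>?A. s z \<odot>\<^bsub>M\<^esub> b z)"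
    using A coeff by (intro M.finsum_addf) (auto simp: Pi_iff)
  also have "\<dots> = free_lift R M b r \<oplus>\<^bsub>M\<^esub> free_lift R M b s"
    using A r s b by (simp add: free_lift_superset[of _ X, where A = ?A])
  finally show "free_lift R M b (r \<oplus>\<^bsub>free_space R X\<^esub> s) = free_lift R M b r \<oplus>\<^bsub>M\<^esub> free_lift R M b s" .
next
  fix k r assume k: "k \<in> carrier R" and r: "r \<in> carrier (free_space R X)"
  let ?A = "{z. r z \<noteq> \<zero>}"
  have A: "finite ?A" "?A \<subseteq> X" "b \<in> ?A \<rightarrow> carrier M"
    using r b by (auto simp: mem_free_space)
  note coeff = free_space_coeff[OF r]
  have "free_lift R M b (k \<odot>\<^bsub>free_space R X\<^esub> r) = (\<Oplus>\<^bsub>M\<^esub>z\<in>?A. (k \<otimes> r z) \<odot>\<^bsub>M\<^esub> b z)"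
    using A r b k by (subst free_lift_superset[of _ X, where A = ?A])
      (auto simp: free_space_smult_closed)
  also have "\<dots> = (\<Oplus>\<^bsub>M\<^esub>z\<in>?A. k \<odot>\<^bsub>M\<^esub> (r z \<odot>\<^bsub>M\<^esub> b z))"
    using A coeff k by (intro M.add.finprod_cong') (auto simp: smult_assoc1 Pi_iff)
  also have "\<dots> = k \<odot>\<^bsub>M\<^esub> free_lift R M b r"
    unfolding free_lift_def using A coeff k by (intro finsum_smult_ldistr[symmetric]) (auto simp: Pi_iff)
  finally show "free_lift R M b (k \<odot>\<^bsub>free_space R X\<^esub> r) = k \<odot>\<^bsub>M\<^esub> free_lift R M b r" .
qed

lemma free_lift_gen:
  assumes "b \<in> X \<rightarrow> carrier M" "x \<in> X"
  shows "free_lift R M b (free_gen R x) = b x"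
proof -
  have "b x \<in> carrier M" using assms by auto
  then show ?thesis
    using assms
    by (subst free_lift_superset[of _ X, where A = "{x}"])
      (auto simp: free_gen_closed, auto simp: free_gen_def split: if_splits)
qed

end

text \<open>From here on the free space is handled through its module operations; pointwise
  unfolding would destroy the terms to which rules for homomorphisms apply.\<close>

declare free_space_simps [simp del]

section \<open>Quotient spaces\<close>

locale quotient_module = module R M for R and M :: "('k, 'v) module" (structure) +
  fixes N
  assumes sub: "submodule R N M"
begin

text \<open>Closure under negation comes from the scalar minus one.\<close>

lemma is_abelian_subgroup: "abelian_subgroup N M"
proof (rule abelian_subgroupI3)
  have "\<ominus>\<^bsub>M\<^esub> v \<in> N" if "v \<in> N" for v
    using submodule.smult_closed[OF sub R.a_inv_closed[OF R.one_closed] that]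
      smult_minus_1[OF subsetD[OF submodule.subset[OF sub] that]]
    by (simp only:)
  moreover have "N \<noteq> {}"
    using submodule.zero_closed[OF sub] by blast
  ultimately show "additive_subgroup N M"
    using submodule.subset[OF sub] submodule.m_closed[OF sub]
    by (intro additive_subgroupI add.subgroupI) (auto simp flip: a_inv_def)
qed (rule M.abelian_group_axioms)

lemmas rcos_self = abelian_subgroup.a_rcos_self[OF is_abelian_subgroup]
  and elemrcos_carrier = abelian_subgroup.a_elemrcos_carrier[OF is_abelian_subgroup]
  and rcos_module = abelian_subgroup.a_rcos_module[OF is_abelian_subgroup]
  and repr_independence = abelian_subgroup.a_repr_independence'[OF is_abelian_subgroup]
  and rcos_sum = abelian_subgroup.a_rcos_sum[OF is_abelian_subgroup]
  and rcos_zero = abelian_subgroup.a_rcos_const[OF is_abelian_subgroup submodule.zero_closed[OF sub]]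

abbreviation proj where "proj v \<equiv> N +>\<^bsub>M\<^esub> v"

lemma carrier_quotient: "carrier (quotient_space M N) = proj ` carrier M"
  by (auto simp: quotient_space_def A_RCOSETS_defs(1) RCOSETS_def a_r_coset_def)

lemma proj_eqD:
  assumes "x \<in> carrier M" "y \<in> proj x"
  shows "y \<in> carrier M" "y \<ominus>\<^bsub>M\<^esub> x \<in> N"
  using elemrcos_carrier[OF assms] rcos_module[OF assms(1), of y] assms(2) by (simp_all add: minus_eq)

lemma proj_eqI:
  assumes "x \<in> carrier M" "y \<in> carrier M" "y \<ominus>\<^bsub>M\<^esub> x \<in> N"
  shows "proj x = proj y"
  using assms rcos_module[OF assms(1,2)] by (intro repr_independence) (simp_all add: minus_eq)

text \<open>The scalar action on a coset is a union over all its representatives. The united cosets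
  all coincide, since y - x in \<open>N\<close> gives k (y - x) in \<open>N\<close>, and the union
  collapses to one of them.\<close>

lemma proj_smult:
  assumes "k \<in> carrier R" "x \<in> carrier M"
  shows "k \<odot>\<^bsub>quotient_space M N\<^esub> proj x = proj (k \<odot>\<^bsub>M\<^esub> x)"
proof -
  have *: "proj (k \<odot>\<^bsub>M\<^esub> y) = proj (k \<odot>\<^bsub>M\<^esub> x)" if "y \<in> proj x" for y
  proof (rule proj_eqI[symmetric])
    note y = proj_eqD[OF assms(2) that]
    have "k \<odot>\<^bsub>M\<^esub> y \<ominus>\<^bsub>M\<^esub> k \<odot>\<^bsub>M\<^esub> x = k \<odot>\<^bsub>M\<^esub> (y \<ominus>\<^bsub>M\<^esub> x)"
      using assms y by (simp add: minus_eq smult_r_distr smult_r_minus)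
    then show "k \<odot>\<^bsub>M\<^esub> y \<ominus>\<^bsub>M\<^esub> k \<odot>\<^bsub>M\<^esub> x \<in> N"
      using assms y by (simp add: submodule.smult_closed[OF sub])
  qed (use assms proj_eqD[OF assms(2) that] in auto)
  have "(\<Union>y\<in>proj x. proj (k \<odot>\<^bsub>M\<^esub> y)) = proj (k \<odot>\<^bsub>M\<^esub> x)"
    using rcos_self[OF assms(2)] by (intro SUP_eq_const *) auto
  then show ?thesis
    by (simp add: quotient_space_def)
qed

lemma proj_add:
  assumes "x \<in> carrier M" "y \<in> carrier M"
  shows "proj x \<oplus>\<^bsub>quotient_space M N\<^esub> proj y = proj (x \<oplus>\<^bsub>M\<^esub> y)"
  using rcos_sum[OF assms] by (simp add: quotient_space_def)

lemma proj_zero: "\<zero>\<^bsub>quotient_space M N\<^esub> = proj \<zero>\<^bsub>M\<^esub>"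
  by (simp add: quotient_space_def rcos_zero)

lemma quotient_cases:
  assumes "A \<in> carrier (quotient_space M N)"
  obtains v where "v \<in> carrier M" "A = proj v"
  using assms unfolding carrier_quotient by blast

lemma proj_closed: "v \<in> carrier M \<Longrightarrow> proj v \<in> carrier (quotient_space M N)"
  by (simp add: carrier_quotient)

lemma quotient_space_abelian_group: "abelian_group (quotient_space M N)"
proof (rule abelian_groupI)
  fix x y z
  assume "x \<in> carrier (quotient_space M N)" "y \<in> carrier (quotient_space M N)"
    "z \<in> carrier (quotient_space M N)"
  then show "x \<oplus>\<^bsub>quotient_space M N\<^esub> y \<oplus>\<^bsub>quotient_space M N\<^esub> z =
      x \<oplus>\<^bsub>quotient_space M N\<^esub> (y \<oplus>\<^bsub>quotient_space M N\<^esub> z)"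
    by (elim quotient_cases) (simp add: proj_add M.a_assoc)
next
  fix x y
  assume "x \<in> carrier (quotient_space M N)" "y \<in> carrier (quotient_space M N)"
  then show "x \<oplus>\<^bsub>quotient_space M N\<^esub> y = y \<oplus>\<^bsub>quotient_space M N\<^esub> x"
    and "x \<oplus>\<^bsub>quotient_space M N\<^esub> y \<in> carrier (quotient_space M N)"
    by (elim quotient_cases; simp add: proj_add M.a_comm proj_closed)+
next
  fix x
  assume x: "x \<in> carrier (quotient_space M N)"
  then show "\<zero>\<^bsub>quotient_space M N\<^esub> \<oplus>\<^bsub>quotient_space M N\<^esub> x = x"
    by (elim quotient_cases) (simp add: proj_add proj_zero)
  obtain v where v: "v \<in> carrier M" "x = proj v"
    using x by (rule quotient_cases)
  then have "proj (\<ominus>\<^bsub>M\<^esub> v) \<oplus>\<^bsub>quotient_space M N\<^esub> x = \<zero>\<^bsub>quotient_space M N\<^esub>"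
    by (simp add: proj_add proj_zero M.l_neg)
  with v show "\<exists>y\<in>carrier (quotient_space M N). y \<oplus>\<^bsub>quotient_space M N\<^esub> x = \<zero>\<^bsub>quotient_space M N\<^esub>"
    by (intro bexI[of _ "proj (\<ominus>\<^bsub>M\<^esub> v)"] proj_closed) simp_all
qed (simp add: proj_zero proj_closed)

lemma quotient_space_module: "module R (quotient_space M N)"
proof (rule moduleI[OF R.is_cring quotient_space_abelian_group])
  fix a b x
  assume "a \<in> carrier R" "b \<in> carrier R" "x \<in> carrier (quotient_space M N)"
  then show "(a \<oplus>\<^bsub>R\<^esub> b) \<odot>\<^bsub>quotient_space M N\<^esub> x =
      a \<odot>\<^bsub>quotient_space M N\<^esub> x \<oplus>\<^bsub>quotient_space M N\<^esub> b \<odot>\<^bsub>quotient_space M N\<^esub> x"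
    and "(a \<otimes>\<^bsub>R\<^esub> b) \<odot>\<^bsub>quotient_space M N\<^esub> x =
      a \<odot>\<^bsub>quotient_space M N\<^esub> (b \<odot>\<^bsub>quotient_space M N\<^esub> x)"
    by (elim quotient_cases; simp add: proj_add proj_smult smult_l_distr smult_assoc1)+
next
  fix a x y
  assume "a \<in> carrier R" "x \<in> carrier (quotient_space M N)" "y \<in> carrier (quotient_space M N)"
  then show "a \<odot>\<^bsub>quotient_space M N\<^esub> (x \<oplus>\<^bsub>quotient_space M N\<^esub> y) =
      a \<odot>\<^bsub>quotient_space M N\<^esub> x \<oplus>\<^bsub>quotient_space M N\<^esub> a \<odot>\<^bsub>quotient_space M N\<^esub> y"
    by (elim quotient_cases) (simp add: proj_add proj_smult smult_r_distr)
next
  fix a x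
  assume "a \<in> carrier R" "x \<in> carrier (quotient_space M N)"
  then show "a \<odot>\<^bsub>quotient_space M N\<^esub> x \<in> carrier (quotient_space M N)"
    by (elim quotient_cases) (simp add: proj_smult proj_closed)
next
  fix x
  assume "x \<in> carrier (quotient_space M N)"
  then show "\<one>\<^bsub>R\<^esub> \<odot>\<^bsub>quotient_space M N\<^esub> x = x"
    by (elim quotient_cases) (simp add: proj_smult)
qed

lemma proj_hom: "proj \<in> module_hom R M (quotient_space M N)"
  by (rule module_homI) (simp_all add: proj_closed proj_add proj_smult)

end

section \<open>Tensor products\<close>

locale module_pair = V: module K V + W: module K W
  for K :: "('k, 'r) ring_scheme" and V :: "('k, 'v) module" and W :: "('k, 'w) module"
begin

abbreviation F where "F \<equiv> free_space K (carrier V \<times> carrier W)"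

sublocale F: module K F
  by (rule V.free_space_module)

abbreviation gen where "gen v w \<equiv> free_gen K (v, w)"

lemma gen_closed: "v \<in> carrier V \<Longrightarrow> w \<in> carrier W \<Longrightarrow> gen v w \<in> carrier F"
  by (simp add: V.free_gen_closed)

lemma relators_subset: "bilinearity_relators K V W \<subseteq> carrier F"
  unfolding bilinearity_relators_def Let_def
  by (auto intro!: F.M.minus_closed F.M.add.m_closed F.smult_closed V.free_gen_closed)

sublocale Q: quotient_module K F "tensor_null K V W"
  unfolding tensor_null_def
  by (intro quotient_module.intro quotient_module_axioms.intro F.module_axioms
      F.span_is_submodule relators_subset)

lemma relator_null: "r \<in> bilinearity_relators K V W \<Longrightarrow> r \<in> tensor_null K V W"
  using F.in_own_span[OF relators_subset] by (auto simp: tensor_null_def)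

lemma gen_relations:
  "v \<in> carrier V \<Longrightarrow> v' \<in> carrier V \<Longrightarrow> w \<in> carrier W \<Longrightarrow>
    gen (v \<oplus>\<^bsub>V\<^esub> v') w \<ominus>\<^bsub>F\<^esub> (gen v w \<oplus>\<^bsub>F\<^esub> gen v' w) \<in> tensor_null K V W"
  "v \<in> carrier V \<Longrightarrow> w \<in> carrier W \<Longrightarrow> w' \<in> carrier W \<Longrightarrow>
    gen v (w \<oplus>\<^bsub>W\<^esub> w') \<ominus>\<^bsub>F\<^esub> (gen v w \<oplus>\<^bsub>F\<^esub> gen v w') \<in> tensor_null K V W"
  "k \<in> carrier K \<Longrightarrow> v \<in> carrier V \<Longrightarrow> w \<in> carrier W \<Longrightarrow>
    gen (k \<odot>\<^bsub>V\<^esub> v) w \<ominus>\<^bsub>F\<^esub> (k \<odot>\<^bsub>F\<^esub> gen v w) \<in> tensor_null K V W"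
  "k \<in> carrier K \<Longrightarrow> v \<in> carrier V \<Longrightarrow> w \<in> carrier W \<Longrightarrow>
    gen v (k \<odot>\<^bsub>W\<^esub> w) \<ominus>\<^bsub>F\<^esub> (k \<odot>\<^bsub>F\<^esub> gen v w) \<in> tensor_null K V W"
  by (rule relator_null, unfold bilinearity_relators_def Let_def, blast)+

lemma tensor_module: "module K (tensor K V W)"
  using Q.quotient_space_module by (simp add: tensor_def)

lemma pure_tensor_proj: "pure_tensor K V W v w = Q.proj (gen v w)"
  by (simp add: pure_tensor_def)

lemma pure_tensor_closed:
  "v \<in> carrier V \<Longrightarrow> w \<in> carrier W \<Longrightarrow> pure_tensor K V W v w \<in> carrier (tensor K V W)"
  by (simp add: pure_tensor_proj tensor_def Q.proj_closed gen_closed)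

text \<open>Each of the four families of relators vanishes in the quotient and there becomes one of
  the four laws of bilinearity.\<close>

lemma pure_tensor_bilinear: "bilinear_on K V W (tensor K V W) (pure_tensor K V W)"
  unfolding bilinear_on_def
proof (intro conjI ballI)
  fix v assume v: "v \<in> carrier V"
  show "pure_tensor K V W v \<in> module_hom K W (tensor K V W)"
  proof (rule module_homI)
    fix w w' assume w: "w \<in> carrier W" "w' \<in> carrier W"
    have "Q.proj (gen v w \<oplus>\<^bsub>F\<^esub> gen v w') = Q.proj (gen v (w \<oplus>\<^bsub>W\<^esub> w'))"
      using v w
      by (intro Q.proj_eqI gen_relations) (simp_all add: gen_closed)
    then show "pure_tensor K V W v (w \<oplus>\<^bsub>W\<^esub> w') =
        pure_tensor K V W v w \<oplus>\<^bsub>tensor K V W\<^esub> pure_tensor K V W v w'"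
      using v w by (simp add: pure_tensor_proj tensor_def Q.proj_add gen_closed)
  next
    fix k w assume w: "k \<in> carrier K" "w \<in> carrier W"
    have "Q.proj (k \<odot>\<^bsub>F\<^esub> gen v w) = Q.proj (gen v (k \<odot>\<^bsub>W\<^esub> w))"
      using v w
      by (intro Q.proj_eqI gen_relations) (simp_all add: gen_closed)
    then show "pure_tensor K V W v (k \<odot>\<^bsub>W\<^esub> w) =
        k \<odot>\<^bsub>tensor K V W\<^esub> pure_tensor K V W v w"
      using v w by (simp add: pure_tensor_proj tensor_def Q.proj_smult gen_closed)
  qed (use v in \<open>simp add: pure_tensor_closed\<close>)
next
  fix w assume w: "w \<in> carrier W"
  show "(\<lambda>v. pure_tensor K V W v w) \<in> module_hom K V (tensor K V W)"
  proof (rule module_homI)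
    fix v v' assume v: "v \<in> carrier V" "v' \<in> carrier V"
    have "Q.proj (gen v w \<oplus>\<^bsub>F\<^esub> gen v' w) = Q.proj (gen (v \<oplus>\<^bsub>V\<^esub> v') w)"
      using v w
      by (intro Q.proj_eqI gen_relations) (simp_all add: gen_closed)
    then show "pure_tensor K V W (v \<oplus>\<^bsub>V\<^esub> v') w =
        pure_tensor K V W v w \<oplus>\<^bsub>tensor K V W\<^esub> pure_tensor K V W v' w"
      using v w by (simp add: pure_tensor_proj tensor_def Q.proj_add gen_closed)
  next
    fix k v assume v: "k \<in> carrier K" "v \<in> carrier V"
    have "Q.proj (k \<odot>\<^bsub>F\<^esub> gen v w) = Q.proj (gen (k \<odot>\<^bsub>V\<^esub> v) w)"
      using v w
      by (intro Q.proj_eqI gen_relations) (simp_all add: gen_closed)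
    then show "pure_tensor K V W (k \<odot>\<^bsub>V\<^esub> v) w =
        k \<odot>\<^bsub>tensor K V W\<^esub> pure_tensor K V W v w"
      using v w by (simp add: pure_tensor_proj tensor_def Q.proj_smult gen_closed)
  qed (use w in \<open>simp add: pure_tensor_closed\<close>)
qed

text \<open>Pure tensors are the classes of the free generators, hence they span. All later
  comparisons of two linear maps out of a tensor product rest on this lemma, which avoids
  representatives altogether.\<close>

lemma tensor_hom_ext:
  assumes f: "f \<in> module_hom K (tensor K V W) U" and g: "g \<in> module_hom K (tensor K V W) U"
    and U: "module K U"
    and pure: "\<And>v w. v \<in> carrier V \<Longrightarrow> w \<in> carrier W \<Longrightarrow>
                 f (pure_tensor K V W v w) = g (pure_tensor K V W v w)"
    and t: "t \<in> carrier (tensor K V W)"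
  shows "f t = g t"
proof -
  obtain r where r: "r \<in> carrier F" and t_eq: "t = Q.proj r"
    using t unfolding tensor_def by (rule Q.quotient_cases)
  have f': "(\<lambda>r. f (Q.proj r)) \<in> module_hom K F U" and g': "(\<lambda>r. g (Q.proj r)) \<in> module_hom K F U"
    using module_hom_comp[OF Q.proj_hom] f g by (simp_all add: tensor_def)
  have "f (Q.proj r) = g (Q.proj r)"
    using r
  proof (induction rule: V.free_space_induct)
    case zero
    show ?case
      using module_hom_zero[OF F.module_axioms U f'] module_hom_zero[OF F.module_axioms U g']
      by (simp add: free_space_simps)
  next
    case (step k x s)
    have "(\<lambda>y. k \<otimes>\<^bsub>K\<^esub> free_gen K x y \<oplus>\<^bsub>K\<^esub> s y) = k \<odot>\<^bsub>F\<^esub> free_gen K x \<oplus>\<^bsub>F\<^esub> s"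
      by (simp add: free_space_simps)
    moreover have "f (Q.proj (free_gen K x)) = g (Q.proj (free_gen K x))"
      using step pure by (cases x) (auto simp: pure_tensor_proj)
    ultimately show ?case
      using step f' g' V.free_gen_closed[OF step(2)]
      by (simp add: module_hom_add[OF f'] module_hom_add[OF g']
          module_hom_smult[OF f'] module_hom_smult[OF g'])
  qed
  with t_eq show ?thesis by simp
qed

section \<open>Universal property of the tensor product\<close>

context
  fixes U :: "('k, 'u) module" and b
  assumes U: "module K U" and b: "bilinear_on K V W U b"
begin

interpretation U: module K U by (rule U)

lemma bilinear_closed: "v \<in> carrier V \<Longrightarrow> w \<in> carrier W \<Longrightarrow> b v w \<in> carrier U"
  using module_hom_mem[OF bilinear_on_right[OF b]] .

lemma bilinear_simps:
  "v \<in> carrier V \<Longrightarrow> v' \<in> carrier V \<Longrightarrow> w \<in> carrier W \<Longrightarrow> b (v \<oplus>\<^bsub>V\<^esub> v') w = b v w \<oplus>\<^bsub>U\<^esub> b v' w"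
  "v \<in> carrier V \<Longrightarrow> w \<in> carrier W \<Longrightarrow> w' \<in> carrier W \<Longrightarrow> b v (w \<oplus>\<^bsub>W\<^esub> w') = b v w \<oplus>\<^bsub>U\<^esub> b v w'"
  "k \<in> carrier K \<Longrightarrow> v \<in> carrier V \<Longrightarrow> w \<in> carrier W \<Longrightarrow> b (k \<odot>\<^bsub>V\<^esub> v) w = k \<odot>\<^bsub>U\<^esub> b v w"
  "k \<in> carrier K \<Longrightarrow> v \<in> carrier V \<Longrightarrow> w \<in> carrier W \<Longrightarrow> b v (k \<odot>\<^bsub>W\<^esub> w) = k \<odot>\<^bsub>U\<^esub> b v w"
  using module_hom_add[OF bilinear_on_left[OF b, of w], of v v']
    module_hom_add[OF bilinear_on_right[OF b, of v], of w w']
    module_hom_smult[OF bilinear_on_left[OF b, of w], of k v]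
    module_hom_smult[OF bilinear_on_right[OF b, of v], of k w]
  by simp_all

abbreviation "evaluate \<equiv> free_lift K U (\<lambda>z. b (fst z) (snd z))"

lemma uncurried_closed: "(\<lambda>z. b (fst z) (snd z)) \<in> carrier V \<times> carrier W \<rightarrow> carrier U"
  by (auto intro: bilinear_closed)

lemma evaluate_hom: "evaluate \<in> module_hom K F U"
  by (rule U.free_lift_hom[OF uncurried_closed])

lemma evaluate_gen: "v \<in> carrier V \<Longrightarrow> w \<in> carrier W \<Longrightarrow> evaluate (gen v w) = b v w"
  using U.free_lift_gen[OF uncurried_closed, of "(v, w)"] by simp

interpretation ev: mod_hom K F U evaluate
  by (rule mod_homI[OF F.module_axioms U evaluate_hom])

text \<open>Bilinearity of \<open>b\<close> puts every relator into the kernel of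
  \<open>evaluate\<close>; the kernel is a submodule, so it contains the span of the
  relators.\<close>

lemma tensor_null_kernel: "r \<in> tensor_null K V W \<Longrightarrow> evaluate r = \<zero>\<^bsub>U\<^esub>"
proof -
  have "bilinearity_relators K V W \<subseteq> ev.ker"
    using relators_subset
    unfolding bilinearity_relators_def Let_def ev.ker_def
    by (auto simp: gen_closed evaluate_gen bilinear_simps bilinear_closed)
  from F.span_is_subset[OF this ev.ker_is_submodule]
  show "r \<in> tensor_null K V W \<Longrightarrow> evaluate r = \<zero>\<^bsub>U\<^esub>"
    by (auto simp: tensor_null_def ev.ker_def)
qed

text \<open>Removes the choice operator: the representative picked by \<open>SOME\<close> differs
  from the given \<open>r\<close> by an element of \<open>tensor_null\<close>, where
  \<open>evaluate\<close> vanishes.\<close>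

lemma tensor_lift_proj:
  assumes r: "r \<in> carrier F"
  shows "tensor_lift K U b (Q.proj r) = evaluate r"
proof -
  define s where "s = (SOME s. s \<in> Q.proj r)"
  have s: "s \<in> Q.proj r"
    unfolding s_def by (rule someI[of _ r]) (rule Q.rcos_self[OF r])
  note s' = Q.proj_eqD[OF r s]
  have "evaluate s \<ominus>\<^bsub>U\<^esub> evaluate r = \<zero>\<^bsub>U\<^esub>"
    using tensor_null_kernel[OF s'(2)] s'(1) r by simp
  then have "evaluate s = evaluate r"
    using s'(1) r by simp
  then show ?thesis
    by (simp add: tensor_lift_def free_lift_def s_def Let_def)
qed

lemma tensor_lift_hom: "tensor_lift K U b \<in> module_hom K (tensor K V W) U"
proof (rule module_homI)
  fix x y assume "x \<in> carrier (tensor K V W)" "y \<in> carrier (tensor K V W)"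
  then show "tensor_lift K U b (x \<oplus>\<^bsub>tensor K V W\<^esub> y) = tensor_lift K U b x \<oplus>\<^bsub>U\<^esub> tensor_lift K U b y"
    unfolding tensor_def
    by (elim Q.quotient_cases) (simp add: Q.proj_add tensor_lift_proj)
next
  fix k x assume "k \<in> carrier K" "x \<in> carrier (tensor K V W)"
  then show "tensor_lift K U b (k \<odot>\<^bsub>tensor K V W\<^esub> x) = k \<odot>\<^bsub>U\<^esub> tensor_lift K U b x"
    unfolding tensor_def
    by (elim Q.quotient_cases) (simp add: Q.proj_smult tensor_lift_proj)
next
  fix x assume "x \<in> carrier (tensor K V W)"
  then show "tensor_lift K U b x \<in> carrier U"
    unfolding tensor_def
    by (elim Q.quotient_cases) (simp add: tensor_lift_proj)
qed

lemma tensor_lift_pure: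
  "v \<in> carrier V \<Longrightarrow> w \<in> carrier W \<Longrightarrow> tensor_lift K U b (pure_tensor K V W v w) = b v w"
  by (simp add: pure_tensor_proj tensor_lift_proj gen_closed evaluate_gen)

end

end

section \<open>Tensor products of linear maps\<close>

lemma module_pairI: "module K V \<Longrightarrow> module K W \<Longrightarrow> module_pair K V W"
  by (rule module_pair.intro)

lemma tensor_map_bilinear:
  assumes "module K V'" "module K W'" "f \<in> module_hom K V V'" "g \<in> module_hom K W W'"
  shows "bilinear_on K V W (tensor K V' W') (\<lambda>v w. pure_tensor K V' W' (f v) (g w))"
  by (rule bilinear_on_precomp[OF module_pair.pure_tensor_bilinear[OF module_pairI] assms(3,4)])
    (fact assms)+

lemma tensor_map_hom:
  assumes "module K V" "module K W" "module K V'" "module K W'"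
    and "f \<in> module_hom K V V'" "g \<in> module_hom K W W'"
  shows "tensor_map K V' W' f g \<in> module_hom K (tensor K V W) (tensor K V' W')"
  unfolding tensor_map_def
  by (rule module_pair.tensor_lift_hom[OF module_pairI _ tensor_map_bilinear]
      module_pair.tensor_module[OF module_pairI] assms)+

lemma tensor_map_pure:
  assumes "module K V" "module K W" "module K V'" "module K W'"
    and "f \<in> module_hom K V V'" "g \<in> module_hom K W W'"
    and "v \<in> carrier V" "w \<in> carrier W"
  shows "tensor_map K V' W' f g (pure_tensor K V W v w) = pure_tensor K V' W' (f v) (g w)"
  unfolding tensor_map_def
  by (rule module_pair.tensor_lift_pure[OF module_pairI _ tensor_map_bilinear]
      module_pair.tensor_module[OF module_pairI] assms)+

section \<open>Triple tensor products and the associativity map\<close>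

locale module_triple = U: module K U + V: module K V + W: module K W
  for K :: "('k, 'r) ring_scheme" and U :: "('k, 'u) module" and V :: "('k, 'v) module"
    and W :: "('k, 'w) module"
begin

lemmas pair_modules = U.module_axioms V.module_axioms W.module_axioms

lemma UV: "module_pair K U V"
  and VW: "module_pair K V W"
  by (intro module_pairI pair_modules)+

lemma UV_W: "module_pair K (tensor K U V) W"
  and U_VW: "module_pair K U (tensor K V W)"
  by (intro module_pairI pair_modules module_pair.tensor_module UV VW)+

abbreviation "triple_tensor \<equiv> tensor K U (tensor K V W)"
abbreviation "triple u v w \<equiv> pure_tensor K U (tensor K V W) u (pure_tensor K V W v w)"

lemma triple_tensor_module: "module K triple_tensor"
  by (rule module_pair.tensor_module[OF U_VW])

lemma triple_hom_fst:
  "v \<in> carrier V \<Longrightarrow> w \<in> carrier W \<Longrightarrow> (\<lambda>u. triple u v w) \<in> module_hom K U triple_tensor"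
  by (intro bilinear_on_left[OF module_pair.pure_tensor_bilinear[OF U_VW]]
      module_pair.pure_tensor_closed[OF VW])

lemma triple_hom_snd:
  "u \<in> carrier U \<Longrightarrow> w \<in> carrier W \<Longrightarrow> (\<lambda>v. triple u v w) \<in> module_hom K V triple_tensor"
  by (rule module_hom_comp[OF
      bilinear_on_left[OF module_pair.pure_tensor_bilinear[OF VW]]
      bilinear_on_right[OF module_pair.pure_tensor_bilinear[OF U_VW]]])

lemma triple_hom_trd:
  "u \<in> carrier U \<Longrightarrow> v \<in> carrier V \<Longrightarrow> (\<lambda>w. triple u v w) \<in> module_hom K W triple_tensor"
  by (rule module_hom_comp[OF
      bilinear_on_right[OF module_pair.pure_tensor_bilinear[OF VW]]
      bilinear_on_right[OF module_pair.pure_tensor_bilinear[OF U_VW]]])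

lemma triple_bilinear: "w \<in> carrier W \<Longrightarrow> bilinear_on K U V triple_tensor (\<lambda>u v. triple u v w)"
  by (simp add: bilinear_on_def triple_hom_fst triple_hom_snd)

text \<open>The inner lift of \<open>tensor_assoc\<close>, with the third factor held fixed.\<close>

abbreviation "regroup w \<equiv> tensor_lift K triple_tensor (\<lambda>u v. triple u v w)"

lemma regroup_hom: "w \<in> carrier W \<Longrightarrow> regroup w \<in> module_hom K (tensor K U V) triple_tensor"
  by (rule module_pair.tensor_lift_hom[OF UV triple_tensor_module triple_bilinear])

lemma regroup_pure:
  "u \<in> carrier U \<Longrightarrow> v \<in> carrier V \<Longrightarrow> w \<in> carrier W \<Longrightarrow>
    regroup w (pure_tensor K U V u v) = triple u v w"
  by (rule module_pair.tensor_lift_pure[OF UV triple_tensor_module triple_bilinear])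

text \<open>Linearity in the tensor \<open>t\<close> is the universal property. Linearity in
  \<open>w\<close> is less direct, because \<open>w\<close> sits inside the function being lifted:
  for fixed scalars and vectors both sides are linear in \<open>t\<close>, so they are compared on
  pure tensors, where \<open>triple\<close> is linear in its last slot.\<close>

lemma regroup_bilinear: "bilinear_on K (tensor K U V) W triple_tensor (\<lambda>t w. regroup w t)"
  unfolding bilinear_on_def
proof (intro conjI ballI)
  fix t assume t: "t \<in> carrier (tensor K U V)"
  show "(\<lambda>w. regroup w t) \<in> module_hom K W triple_tensor"
  proof (rule module_homI)
    show "regroup w t \<in> carrier triple_tensor" if "w \<in> carrier W" for w
      by (rule module_hom_mem[OF regroup_hom[OF that] t])
  next
    fix w w' assume w: "w \<in> carrier W" "w' \<in> carrier W"
    show "regroup (w \<oplus>\<^bsub>W\<^esub> w') t = regroup w t \<oplus>\<^bsub>triple_tensor\<^esub> regroup w' t"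
      by (rule module_pair.tensor_hom_ext[OF UV _ _ triple_tensor_module _ t,
            where g = "\<lambda>t. regroup w t \<oplus>\<^bsub>triple_tensor\<^esub> regroup w' t"])
        (use w in \<open>simp_all add: regroup_hom module_hom_sum triple_tensor_module regroup_pure
          module_hom_add[OF triple_hom_trd]\<close>)
  next
    fix k w assume w: "k \<in> carrier K" "w \<in> carrier W"
    show "regroup (k \<odot>\<^bsub>W\<^esub> w) t = k \<odot>\<^bsub>triple_tensor\<^esub> regroup w t"
      by (rule module_pair.tensor_hom_ext[OF UV _ _ triple_tensor_module _ t,
            where g = "\<lambda>t. k \<odot>\<^bsub>triple_tensor\<^esub> regroup w t"])
        (use w in \<open>simp_all add: regroup_hom module_hom_scale triple_tensor_module regroup_pure
          module_hom_smult[OF triple_hom_trd]\<close>)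
  qed
qed (rule regroup_hom)

lemma tensor_assoc_hom:
  "tensor_assoc K U V W \<in> module_hom K (tensor K (tensor K U V) W) triple_tensor"
  unfolding tensor_assoc_def
  by (rule module_pair.tensor_lift_hom[OF UV_W triple_tensor_module regroup_bilinear])

lemma tensor_assoc_pure:
  assumes "u \<in> carrier U" "v \<in> carrier V" "w \<in> carrier W"
  shows "tensor_assoc K U V W (pure_tensor K (tensor K U V) W (pure_tensor K U V u v) w) = triple u v w"
  unfolding tensor_assoc_def
  using module_pair.tensor_lift_pure[OF UV_W triple_tensor_module regroup_bilinear
      module_pair.pure_tensor_closed[OF UV assms(1,2)] assms(3)]
  by (simp add: regroup_pure assms)

end

section \<open>Adjoining a group-like element\<close>

lemma ground_space_simps [simp]:
  "carrier (ground_space K) = carrier K"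
  "\<zero>\<^bsub>ground_space K\<^esub> = \<zero>\<^bsub>K\<^esub>"
  "x \<oplus>\<^bsub>ground_space K\<^esub> y = x \<oplus>\<^bsub>K\<^esub> y"
  "k \<odot>\<^bsub>ground_space K\<^esub> x = k \<otimes>\<^bsub>K\<^esub> x"
  by (simp_all add: ground_space_def)

lemma (in cring) ground_space_module: "module R (ground_space R)"
proof (rule moduleI[OF is_cring])
  show "abelian_group (ground_space R)"
    by (rule abelian_groupI) (auto simp: a_ac intro!: bexI[of _ "\<ominus> x" for x] l_neg)
qed (simp_all add: l_distr r_distr m_assoc)

abbreviation augmented :: "('k, 'r) ring_scheme \<Rightarrow> ('k, 'c) module \<Rightarrow> ('k, 'k \<times> 'c) module" where
  "augmented K C \<equiv> direct_sum (ground_space K) C"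

lemma augmented_simps:
  "carrier (augmented K C) = carrier K \<times> carrier C"
  "\<zero>\<^bsub>augmented K C\<^esub> = (\<zero>\<^bsub>K\<^esub>, \<zero>\<^bsub>C\<^esub>)"
  "x \<oplus>\<^bsub>augmented K C\<^esub> y = (fst x \<oplus>\<^bsub>K\<^esub> fst y, snd x \<oplus>\<^bsub>C\<^esub> snd y)"
  "k \<odot>\<^bsub>augmented K C\<^esub> x = (k \<otimes>\<^bsub>K\<^esub> fst x, k \<odot>\<^bsub>C\<^esub> snd x)"
  by (simp_all add: direct_sum_def)

section \<open>The enlarged space, its tensor powers and the transport maps\<close>

locale augmentation = C: module K C
  for K :: "('k, 'r) ring_scheme" and C :: "('k, 'c) module"
begin

abbreviation "C' \<equiv> augmented K C"
abbreviation unit_elt ("\<e>") where "\<e> \<equiv> (\<one>\<^bsub>K\<^esub>, \<zero>\<^bsub>C\<^esub>)"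
abbreviation embed ("\<iota>") where "\<iota> \<equiv> Pair \<zero>\<^bsub>K\<^esub>"

sublocale C': module K C'
  by (rule direct_sum_is_module[OF C.ground_space_module C.module_axioms])

lemma unit_closed: "\<e> \<in> carrier C'"
  by (simp add: augmented_simps)

lemma embed_hom: "\<iota> \<in> module_hom K C C'"
  by (rule module_homI) (simp_all add: augmented_simps)

lemma embed_closed: "c \<in> carrier C \<Longrightarrow> \<iota> c \<in> carrier C'"
  by (simp add: augmented_simps)

lemma fst_hom: "fst \<in> module_hom K C' (ground_space K)"
  by (rule module_homI) (auto simp: augmented_simps)

lemma snd_hom: "snd \<in> module_hom K C' C"
  by (rule module_homI) (auto simp: augmented_simps)

text \<open>Every element is a multiple of \<e> plus an embedded element of \<open>C\<close>. Each
  identity for the extended structure is thereby reduced to one check at \<e> and one at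
  \<open>\<iota> c\<close>.\<close>

lemma augmented_hom_ext:
  assumes f: "f \<in> module_hom K C' N" and g: "g \<in> module_hom K C' N"
    and unit: "f \<e> = g \<e>" and embed: "\<And>c. c \<in> carrier C \<Longrightarrow> f (\<iota> c) = g (\<iota> c)"
    and x: "x \<in> carrier C'"
  shows "f x = g x"
proof -
  obtain k c where kc: "x = (k, c)" "k \<in> carrier K" "c \<in> carrier C"
    using x by (auto simp: augmented_simps)
  then have "x = k \<odot>\<^bsub>C'\<^esub> \<e> \<oplus>\<^bsub>C'\<^esub> \<iota> c"
    by (simp add: augmented_simps)
  then show ?thesis
    using kc unit embed
    by (simp add: module_hom_add[OF f] module_hom_add[OF g] module_hom_smult[OF f]
        module_hom_smult[OF g] unit_closed embed_closed)
qed

abbreviation "T \<equiv> tensor K C' C'"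
abbreviation tens (infixl "\<boxtimes>" 70) where "x \<boxtimes> y \<equiv> pure_tensor K C' C' x y"
text \<open>The inclusion of C \<otimes> C into the larger tensor square. It has to be an explicit
  map because the two tensor products consist of cosets of functions on different index
  sets.\<close>

abbreviation "I \<equiv> tensor_map K C' C' \<iota> \<iota>"

sublocale CC: module_pair K C C
  by (intro module_pairI C.module_axioms)

sublocale C'C': module_pair K C' C'
  by (intro module_pairI C'.module_axioms)

sublocale T: module K T
  by (rule C'C'.tensor_module)

sublocale T3: module_triple K C' C' C'
  by (intro module_triple.intro C'.module_axioms)

sublocale C3: module_triple K C C C
  by (intro module_triple.intro C.module_axioms)

abbreviation "CC \<equiv> tensor K C C"

lemmas tens_closed = C'C'.pure_tensor_closed

lemma tens_hom_left: "y \<in> carrier C' \<Longrightarrow> (\<lambda>x. x \<boxtimes> y) \<in> module_hom K C' T"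
  by (rule bilinear_on_left[OF C'C'.pure_tensor_bilinear])

lemma tens_hom_right: "x \<in> carrier C' \<Longrightarrow> (\<lambda>y. x \<boxtimes> y) \<in> module_hom K C' T"
  by (rule bilinear_on_right[OF C'C'.pure_tensor_bilinear])

lemma I_hom: "I \<in> module_hom K CC T"
  by (rule tensor_map_hom[OF C.module_axioms C.module_axioms C'.module_axioms C'.module_axioms
        embed_hom embed_hom])

lemma I_closed: "t \<in> carrier CC \<Longrightarrow> I t \<in> carrier T"
  by (rule module_hom_mem[OF I_hom])

lemma I_pure:
  "a \<in> carrier C \<Longrightarrow> b \<in> carrier C \<Longrightarrow> I (pure_tensor K C C a b) = \<iota> a \<boxtimes> \<iota> b"
  by (rule tensor_map_pure[OF C.module_axioms C.module_axioms C'.module_axioms C'.module_axioms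
        embed_hom embed_hom])

lemma embed_zero: "\<iota> \<zero>\<^bsub>C\<^esub> = \<zero>\<^bsub>C'\<^esub>"
  by (simp add: augmented_simps)

lemma tens_zero_left: "y \<in> carrier C' \<Longrightarrow> \<zero>\<^bsub>C'\<^esub> \<boxtimes> y = \<zero>\<^bsub>T\<^esub>"
  by (rule module_hom_zero[OF C'.module_axioms T.module_axioms tens_hom_left])

lemma tens_zero_right: "x \<in> carrier C' \<Longrightarrow> x \<boxtimes> \<zero>\<^bsub>C'\<^esub> = \<zero>\<^bsub>T\<^esub>"
  by (rule module_hom_zero[OF C'.module_axioms T.module_axioms tens_hom_right])

lemma smult_fst_hom:
  assumes "t \<in> carrier T"
  shows "(\<lambda>x. fst x \<odot>\<^bsub>T\<^esub> t) \<in> module_hom K C' T"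
  by (rule module_homI)
    (use assms in \<open>auto simp: augmented_simps T.smult_l_distr T.smult_assoc1\<close>)

text \<open>The two bracketings of a triple tensor have different types, hence two symbols. Both
  bind more weakly than \<boxtimes>, so \<open>x \<rhd> y \<boxtimes> z\<close> is bracketed to the
  right and \<open>x \<boxtimes> y \<lhd> z\<close> to the left.\<close>

abbreviation T3_tens (infixr "\<rhd>" 65) where "x \<rhd> t \<equiv> pure_tensor K C' T x t"
abbreviation TC_tens (infixl "\<lhd>" 65) where "t \<lhd> x \<equiv> pure_tensor K T C' t x"
abbreviation "T3 \<equiv> tensor K C' T"

sublocale C'T: module_pair K C' T
  by (rule T3.U_VW)
sublocale TC': module_pair K T C'
  by (rule T3.UV_W)
sublocale C_CC: module_pair K C CC
  by (rule C3.U_VW)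
sublocale CC_C: module_pair K CC C
  by (rule C3.UV_W)

lemma assoc_pure:
  "x \<in> carrier C' \<Longrightarrow> y \<in> carrier C' \<Longrightarrow> z \<in> carrier C' \<Longrightarrow>
    tensor_assoc K C' C' C' (x \<boxtimes> y \<lhd> z) = x \<rhd> y \<boxtimes> z"
  by (rule T3.tensor_assoc_pure)

lemma assoc_hom: "z \<in> carrier C' \<Longrightarrow> (\<lambda>t. tensor_assoc K C' C' C' (t \<lhd> z)) \<in> module_hom K T T3"
  by (rule module_hom_comp[OF bilinear_on_left[OF TC'.pure_tensor_bilinear] T3.tensor_assoc_hom])

abbreviation "I3 \<equiv> tensor_map K C' T \<iota> I"

lemma I3_hom: "I3 \<in> module_hom K (tensor K C CC) T3"
  by (rule tensor_map_hom[OF C.module_axioms CC.tensor_module C'.module_axioms T.module_axioms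
        embed_hom I_hom])

lemma I3_pure:
  "a \<in> carrier C \<Longrightarrow> t \<in> carrier CC \<Longrightarrow> I3 (pure_tensor K C CC a t) = \<iota> a \<rhd> I t"
  by (rule tensor_map_pure[OF C.module_axioms CC.tensor_module C'.module_axioms T.module_axioms
        embed_hom I_hom])

text \<open>Naturality of the associativity map with respect to the embedding. It is stated with a
  general \<open>t\<close> in the first slot because it is applied with \<open>t\<close> equal to
  \<open>\<Delta> a\<close>, which is not a pure tensor.\<close>

lemma I3_assoc:
  assumes t: "t \<in> carrier CC" and b: "b \<in> carrier C"
  shows "I3 (tensor_assoc K C C C (pure_tensor K CC C t b)) =
    tensor_assoc K C' C' C' (I t \<lhd> \<iota> b)"
proof (rule CC.tensor_hom_ext[OF _ _ T3.triple_tensor_module _ t])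
  show "(\<lambda>t. I3 (tensor_assoc K C C C (pure_tensor K CC C t b))) \<in> module_hom K CC T3"
    using b by (intro module_hom_comp[OF _ I3_hom] module_hom_comp[OF _ C3.tensor_assoc_hom]
        bilinear_on_left[OF CC_C.pure_tensor_bilinear])
  show "(\<lambda>t. tensor_assoc K C' C' C' (I t \<lhd> \<iota> b)) \<in> module_hom K CC T3"
    by (rule module_hom_comp[OF I_hom assoc_hom[OF embed_closed[OF b]]])
qed (simp add: b C3.tensor_assoc_pure I3_pure I_pure assoc_pure embed_closed CC.pure_tensor_closed)

lemma insert_unit_homs:
  "(\<lambda>b. \<e> \<boxtimes> \<iota> b) \<in> module_hom K C T" "(\<lambda>b. \<iota> b \<boxtimes> \<e>) \<in> module_hom K C T"
  by (rule module_hom_comp[OF embed_hom tens_hom_right[OF unit_closed]]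
      module_hom_comp[OF embed_hom tens_hom_left[OF unit_closed]])+

text \<open>These insert \<e> into a tensor of C \<otimes> C: \<open>G\<close> in the middle slot,
  \<open>H\<close> in the last one. Insertion in the first slot is \<open>\<e> \<rhd> I t\<close>,
  which is visibly linear in \<open>t\<close>.\<close>

abbreviation "G \<equiv> tensor_map K C' T \<iota> (\<lambda>b. \<e> \<boxtimes> \<iota> b)"
abbreviation "H \<equiv> tensor_map K C' T \<iota> (\<lambda>b. \<iota> b \<boxtimes> \<e>)"

lemma GH_hom: "G \<in> module_hom K CC T3" "H \<in> module_hom K CC T3"
  by (intro tensor_map_hom C.module_axioms C'.module_axioms T.module_axioms embed_hom
      insert_unit_homs)+

lemma GH_pure:
  assumes "a \<in> carrier C" "b \<in> carrier C"
  shows "G (pure_tensor K C C a b) = \<iota> a \<rhd> \<e> \<boxtimes> \<iota> b"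
    and "H (pure_tensor K C C a b) = \<iota> a \<rhd> \<iota> b \<boxtimes> \<e>"
  using assms tensor_map_pure[OF C.module_axioms C.module_axioms C'.module_axioms T.module_axioms embed_hom]
    insert_unit_homs by simp_all

text \<open>The summand \<Delta> c \<otimes> \<e> appears bracketed to the left on one side of
  coassociativity and as \<open>H\<close> on the other.\<close>

lemma assoc_unit_right:
  assumes t: "t \<in> carrier CC"
  shows "tensor_assoc K C' C' C' (I t \<lhd> \<e>) = H t"
  by (rule CC.tensor_hom_ext[OF module_hom_comp[OF I_hom assoc_hom[OF unit_closed]] GH_hom(2)
        T3.triple_tensor_module _ t])
    (simp add: GH_pure I_pure assoc_pure embed_closed unit_closed)

end

section \<open>The extended comultiplication and its coassociativity\<close>

locale coalgebra_augmentation = noncounitary_coalgebra K C \<Delta>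
  for K :: "('k, 'r) ring_scheme" and C :: "('k, 'c) module"
    and \<Delta> :: "'c \<Rightarrow> ('c \<times> 'c \<Rightarrow> 'k) set"
begin

sublocale augmentation K C
  using comult_linear by (auto simp: augmentation_def linear_map_def mod_hom_def)

lemma comult_hom: "\<Delta> \<in> module_hom K C CC"
  using comult_linear by (simp add: linear_map_def mod_hom_def mod_hom_axioms_def)

lemma comult_closed: "c \<in> carrier C \<Longrightarrow> \<Delta> c \<in> carrier CC"
  by (rule module_hom_mem[OF comult_hom])

definition comult' ("\<Delta>''") where
  "\<Delta>' x = fst x \<odot>\<^bsub>T\<^esub> (\<e> \<boxtimes> \<e>) \<oplus>\<^bsub>T\<^esub>
     (I (\<Delta> (snd x)) \<oplus>\<^bsub>T\<^esub> (\<e> \<boxtimes> \<iota> (snd x) \<oplus>\<^bsub>T\<^esub> \<iota> (snd x) \<boxtimes> \<e>))"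

lemma comult'_hom: "\<Delta>' \<in> module_hom K C' T"
  unfolding comult'_def
  by (intro module_hom_sum T.module_axioms smult_fst_hom tens_closed unit_closed
      module_hom_comp[OF snd_hom] module_hom_comp[OF comult_hom I_hom]
      module_hom_comp[OF embed_hom tens_hom_left] module_hom_comp[OF embed_hom tens_hom_right])

lemma comult'_unit: "\<Delta>' \<e> = \<e> \<boxtimes> \<e>"
proof -
  have "I (\<Delta> \<zero>\<^bsub>C\<^esub>) = \<zero>\<^bsub>T\<^esub>"
    using module_hom_zero[OF C.module_axioms T.module_axioms module_hom_comp[OF comult_hom I_hom]] .
  then show ?thesis
    using tens_closed[OF unit_closed unit_closed]
    by (simp add: comult'_def embed_zero tens_zero_left tens_zero_right unit_closed)
qed

lemma comult'_embed:
  assumes "c \<in> carrier C"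
  shows "\<Delta>' (\<iota> c) = I (\<Delta> c) \<oplus>\<^bsub>T\<^esub> (\<e> \<boxtimes> \<iota> c \<oplus>\<^bsub>T\<^esub> \<iota> c \<boxtimes> \<e>)"
  using assms by (simp add: comult'_def I_closed comult_closed tens_closed unit_closed embed_closed)

text \<open>The two sides of coassociativity, taken as linear maps on all of \<open>T\<close> so
  that they can be distributed over the summands of \<open>\<Delta>' x\<close>.\<close>

abbreviation "A \<equiv> \<lambda>t. tensor_assoc K C' C' C' (tensor_map K T C' \<Delta>' id t)"
abbreviation "B \<equiv> tensor_map K C' T id \<Delta>'"

sublocale T3m: module K T3
  by (rule T3.triple_tensor_module)

lemma A_hom: "A \<in> module_hom K T T3"
  by (rule module_hom_comp[OF tensor_map_hom T3.tensor_assoc_hom])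
    (intro C'.module_axioms T.module_axioms comult'_hom module_hom_id)+

lemma B_hom: "B \<in> module_hom K T T3"
  by (intro tensor_map_hom C'.module_axioms T.module_axioms comult'_hom module_hom_id)

lemma A_pure:
  "x \<in> carrier C' \<Longrightarrow> y \<in> carrier C' \<Longrightarrow> A (x \<boxtimes> y) = tensor_assoc K C' C' C' (\<Delta>' x \<lhd> y)"
  using tensor_map_pure[OF C'.module_axioms C'.module_axioms T.module_axioms C'.module_axioms
      comult'_hom module_hom_id] by simp

lemma B_pure: "x \<in> carrier C' \<Longrightarrow> y \<in> carrier C' \<Longrightarrow> B (x \<boxtimes> y) = x \<rhd> \<Delta>' y"
  using tensor_map_pure[OF C'.module_axioms C'.module_axioms C'.module_axioms T.module_axioms
      module_hom_id comult'_hom] by simp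

lemma T3_closed: "x \<in> carrier C' \<Longrightarrow> t \<in> carrier T \<Longrightarrow> x \<rhd> t \<in> carrier T3"
  by (rule C'T.pure_tensor_closed)

lemma assoc_add:
  "s \<in> carrier T \<Longrightarrow> t \<in> carrier T \<Longrightarrow> z \<in> carrier C' \<Longrightarrow>
    tensor_assoc K C' C' C' ((s \<oplus>\<^bsub>T\<^esub> t) \<lhd> z) =
      tensor_assoc K C' C' C' (s \<lhd> z) \<oplus>\<^bsub>T3\<^esub> tensor_assoc K C' C' C' (t \<lhd> z)"
  by (rule module_hom_add[OF assoc_hom])

lemma T3_add:
  "x \<in> carrier C' \<Longrightarrow> s \<in> carrier T \<Longrightarrow> t \<in> carrier T \<Longrightarrow>
    x \<rhd> (s \<oplus>\<^bsub>T\<^esub> t) = (x \<rhd> s) \<oplus>\<^bsub>T3\<^esub> (x \<rhd> t)"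
  by (rule module_hom_add[OF bilinear_on_right[OF C'T.pure_tensor_bilinear]])

lemma A_unit: "y \<in> carrier C' \<Longrightarrow> A (\<e> \<boxtimes> y) = \<e> \<rhd> \<e> \<boxtimes> y"
  by (simp add: A_pure unit_closed comult'_unit assoc_pure)

lemma A_embed:
  "a \<in> carrier C \<Longrightarrow> y \<in> carrier C' \<Longrightarrow>
    A (\<iota> a \<boxtimes> y) = tensor_assoc K C' C' C' (I (\<Delta> a) \<lhd> y) \<oplus>\<^bsub>T3\<^esub>
      ((\<e> \<rhd> \<iota> a \<boxtimes> y) \<oplus>\<^bsub>T3\<^esub> (\<iota> a \<rhd> \<e> \<boxtimes> y))"
  by (simp add: A_pure embed_closed comult'_embed assoc_add assoc_pure unit_closed
      I_closed comult_closed tens_closed)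

lemma B_unit: "x \<in> carrier C' \<Longrightarrow> B (x \<boxtimes> \<e>) = x \<rhd> \<e> \<boxtimes> \<e>"
  by (simp add: B_pure unit_closed comult'_unit)

lemma B_embed:
  "b \<in> carrier C \<Longrightarrow> x \<in> carrier C' \<Longrightarrow>
    B (x \<boxtimes> \<iota> b) = (x \<rhd> I (\<Delta> b)) \<oplus>\<^bsub>T3\<^esub>
      ((x \<rhd> \<e> \<boxtimes> \<iota> b) \<oplus>\<^bsub>T3\<^esub> (x \<rhd> \<iota> b \<boxtimes> \<e>))"
  by (simp add: B_pure embed_closed comult'_embed T3_add unit_closed
      I_closed comult_closed tens_closed)

lemma CC_maps:
  "tensor_map K CC C \<Delta> id \<in> module_hom K CC (tensor K CC C)"
  "tensor_map K C CC id \<Delta> \<in> module_hom K CC (tensor K C CC)"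
  by (intro tensor_map_hom C.module_axioms CC.tensor_module comult_hom module_hom_id)+

lemma CC_maps_pure:
  assumes "a \<in> carrier C" "b \<in> carrier C"
  shows "tensor_map K CC C \<Delta> id (pure_tensor K C C a b) = pure_tensor K CC C (\<Delta> a) b"
    and "tensor_map K C CC id \<Delta> (pure_tensor K C C a b) = pure_tensor K C CC a (\<Delta> b)"
  using assms
    tensor_map_pure[OF C.module_axioms C.module_axioms CC.tensor_module C.module_axioms
      comult_hom module_hom_id]
    tensor_map_pure[OF C.module_axioms C.module_axioms C.module_axioms CC.tensor_module
      module_hom_id comult_hom] by simp_all

text \<open>On a \<otimes> b the first factor is expanded. The part \<Delta> a gives the left side
  of coassociativity of \<Delta>, while \<e> \<otimes> a and a \<otimes> \<e> put \<e> into the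
  first and the middle slot.\<close>

lemma A_I:
  assumes t: "t \<in> carrier CC"
  shows "A (I t) = I3 (tensor_assoc K C C C (tensor_map K CC C \<Delta> id t)) \<oplus>\<^bsub>T3\<^esub>
    ((\<e> \<rhd> I t) \<oplus>\<^bsub>T3\<^esub> G t)"
proof (rule CC.tensor_hom_ext[OF _ _ T3m.module_axioms _ t])
  show "(\<lambda>t. A (I t)) \<in> module_hom K CC T3"
    by (rule module_hom_comp[OF I_hom A_hom])
  show "(\<lambda>t. I3 (tensor_assoc K C C C (tensor_map K CC C \<Delta> id t)) \<oplus>\<^bsub>T3\<^esub>
    ((\<e> \<rhd> I t) \<oplus>\<^bsub>T3\<^esub> G t)) \<in> module_hom K CC T3"
    by (intro module_hom_sum T3m.module_axioms GH_hom
        module_hom_comp[OF module_hom_comp[OF CC_maps(1) C3.tensor_assoc_hom] I3_hom]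
        module_hom_comp[OF I_hom bilinear_on_right[OF C'T.pure_tensor_bilinear unit_closed]])
  fix a b assume "a \<in> carrier C" "b \<in> carrier C"
  then show "A (I (pure_tensor K C C a b)) =
      I3 (tensor_assoc K C C C (tensor_map K CC C \<Delta> id (pure_tensor K C C a b))) \<oplus>\<^bsub>T3\<^esub>
      ((\<e> \<rhd> I (pure_tensor K C C a b)) \<oplus>\<^bsub>T3\<^esub> G (pure_tensor K C C a b))"
    by (simp add: I_pure A_embed embed_closed CC_maps_pure I3_assoc comult_closed GH_pure)
qed

text \<open>Here the second factor is expanded, so \<e> enters the middle and the last slot. The
  term \<open>G\<close> is common with \<open>A_I\<close>; the other two insertions are supplied by
  the cross terms of \<open>\<Delta>' c\<close>.\<close>

lemma B_I:
  assumes t: "t \<in> carrier CC"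
  shows "B (I t) = I3 (tensor_map K C CC id \<Delta> t) \<oplus>\<^bsub>T3\<^esub> (G t \<oplus>\<^bsub>T3\<^esub> H t)"
proof (rule CC.tensor_hom_ext[OF _ _ T3m.module_axioms _ t])
  show "(\<lambda>t. B (I t)) \<in> module_hom K CC T3"
    by (rule module_hom_comp[OF I_hom B_hom])
  show "(\<lambda>t. I3 (tensor_map K C CC id \<Delta> t) \<oplus>\<^bsub>T3\<^esub> (G t \<oplus>\<^bsub>T3\<^esub> H t)) \<in> module_hom K CC T3"
    by (intro module_hom_sum T3m.module_axioms GH_hom module_hom_comp[OF CC_maps(2) I3_hom])
  fix a b assume "a \<in> carrier C" "b \<in> carrier C"
  then show "B (I (pure_tensor K C C a b)) =
      I3 (tensor_map K C CC id \<Delta> (pure_tensor K C C a b)) \<oplus>\<^bsub>T3\<^esub>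
      (G (pure_tensor K C C a b) \<oplus>\<^bsub>T3\<^esub> H (pure_tensor K C C a b))"
    by (simp add: I_pure B_embed embed_closed CC_maps_pure I3_pure comult_closed GH_pure)
qed

text \<open>At \<open>\<iota> c\<close> both sides are sums of seven terms, one for each pattern of
  slots filled by \<e> or from \<open>C\<close> except the pattern with \<e> everywhere. The three
  patterns with two copies of \<e> carry \<open>c\<close> itself, the three with one copy carry
  \<Delta> c, and the last one is the iterated comultiplication of \<open>c\<close>.\<close>

lemma comult'_coassoc:
  assumes x: "x \<in> carrier C'"
  shows "A (\<Delta>' x) = B (\<Delta>' x)"
proof (rule augmented_hom_ext[OF _ _ _ _ x])
  show "(\<lambda>x. A (\<Delta>' x)) \<in> module_hom K C' T3"
    by (rule module_hom_comp[OF comult'_hom A_hom])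
  show "(\<lambda>x. B (\<Delta>' x)) \<in> module_hom K C' T3"
    by (rule module_hom_comp[OF comult'_hom B_hom])
  show "A (\<Delta>' \<e>) = B (\<Delta>' \<e>)"
    by (simp add: comult'_unit A_unit B_unit unit_closed)
  fix c assume c: "c \<in> carrier C"
  note closed = c comult_closed[OF c] I_closed[OF comult_closed[OF c]] embed_closed[OF c] unit_closed
  \<comment> \<open>The only term in which coassociativity of \<Delta> is used. Named
    \<open>u\<close> on both sides, it is opaque to the final rewriting by associativity and
    commutativity.\<close>
  define u where "u = I3 (tensor_map K C CC id \<Delta> (\<Delta> c))"
  have "u \<in> carrier T3" "G (\<Delta> c) \<in> carrier T3" "H (\<Delta> c) \<in> carrier T3"
    unfolding u_def using closed
    by (auto intro!: module_hom_mem[OF I3_hom] module_hom_mem[OF CC_maps(2)] module_hom_mem[OF GH_hom(1)]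
        module_hom_mem[OF GH_hom(2)])
  moreover have "A (\<Delta>' (\<iota> c)) = (u \<oplus>\<^bsub>T3\<^esub> ((\<e> \<rhd> I (\<Delta> c)) \<oplus>\<^bsub>T3\<^esub> G (\<Delta> c))) \<oplus>\<^bsub>T3\<^esub>
      ((\<e> \<rhd> \<e> \<boxtimes> \<iota> c) \<oplus>\<^bsub>T3\<^esub> (H (\<Delta> c) \<oplus>\<^bsub>T3\<^esub> ((\<e> \<rhd> \<iota> c \<boxtimes> \<e>) \<oplus>\<^bsub>T3\<^esub> (\<iota> c \<rhd> \<e> \<boxtimes> \<e>))))"
    using closed
    by (simp add: comult'_embed module_hom_add[OF A_hom] tens_closed A_I A_unit A_embed
        assoc_unit_right coassoc u_def)
  moreover have "B (\<Delta>' (\<iota> c)) = (u \<oplus>\<^bsub>T3\<^esub> (G (\<Delta> c) \<oplus>\<^bsub>T3\<^esub> H (\<Delta> c))) \<oplus>\<^bsub>T3\<^esub>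
      (((\<e> \<rhd> I (\<Delta> c)) \<oplus>\<^bsub>T3\<^esub> ((\<e> \<rhd> \<e> \<boxtimes> \<iota> c) \<oplus>\<^bsub>T3\<^esub> (\<e> \<rhd> \<iota> c \<boxtimes> \<e>))) \<oplus>\<^bsub>T3\<^esub> (\<iota> c \<rhd> \<e> \<boxtimes> \<e>))"
    using closed
    by (simp add: comult'_embed module_hom_add[OF B_hom] tens_closed B_I B_unit B_embed u_def)
  ultimately show "A (\<Delta>' (\<iota> c)) = B (\<Delta>' (\<iota> c))"
    using closed by (simp add: T3_closed tens_closed T3m.M.a_ac)
qed

section \<open>Counit laws\<close>

lemma comult'_counit_left:
  assumes x: "x \<in> carrier C'"
  shows "tensor_map K (ground_space K) C' fst id (\<Delta>' x) = pure_tensor K (ground_space K) C' \<one>\<^bsub>K\<^esub> x"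
proof -
  let ?E = "tensor_map K (ground_space K) C' fst id"
  interpret KC': module_pair K "ground_space K" C'
    by (intro module_pairI C.ground_space_module C'.module_axioms)
  interpret KT: module K "tensor K (ground_space K) C'"
    by (rule KC'.tensor_module)
  have E_hom: "?E \<in> module_hom K T (tensor K (ground_space K) C')"
    by (intro tensor_map_hom C'.module_axioms C.ground_space_module fst_hom module_hom_id)
  have E_pure: "?E (y \<boxtimes> z) = pure_tensor K (ground_space K) C' (fst y) z"
    if "y \<in> carrier C'" "z \<in> carrier C'" for y z
    using tensor_map_pure[OF C'.module_axioms C'.module_axioms C.ground_space_module
        C'.module_axioms fst_hom module_hom_id that] by simp
  have null: "pure_tensor K (ground_space K) C' \<zero>\<^bsub>K\<^esub> z = \<zero>\<^bsub>tensor K (ground_space K) C'\<^esub>"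
    if "z \<in> carrier C'" for z
    using module_hom_zero[OF C.ground_space_module KT.module_axioms
        bilinear_on_left[OF KC'.pure_tensor_bilinear that]] by simp
  \<comment> \<open>The projection \<open>fst\<close> vanishes on embedded elements, so the whole
    summand coming from \<Delta> c is killed. Of the cross terms only \<e> \<otimes> c survives,
    with first factor \<open>fst \<e>\<close>, which is one.\<close>
  have E_I: "?E (I t) = \<zero>\<^bsub>tensor K (ground_space K) C'\<^esub>" if t: "t \<in> carrier CC" for t
    by (rule CC.tensor_hom_ext[OF module_hom_comp[OF I_hom E_hom]
          module_hom_zero_map[OF KT.module_axioms] KT.module_axioms _ t])
      (simp add: I_pure E_pure embed_closed null)
  have right_hom: "pure_tensor K (ground_space K) C' \<one>\<^bsub>K\<^esub> \<in>
      module_hom K C' (tensor K (ground_space K) C')"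
    by (rule bilinear_on_right[OF KC'.pure_tensor_bilinear]) simp
  show ?thesis
  proof (rule augmented_hom_ext[OF module_hom_comp[OF comult'_hom E_hom] right_hom _ _ x])
    show "?E (\<Delta>' \<e>) = pure_tensor K (ground_space K) C' \<one>\<^bsub>K\<^esub> \<e>"
      by (simp add: comult'_unit E_pure unit_closed)
    fix c assume c: "c \<in> carrier C"
    show "?E (\<Delta>' (\<iota> c)) = pure_tensor K (ground_space K) C' \<one>\<^bsub>K\<^esub> (\<iota> c)"
      using c by (simp add: comult'_embed module_hom_add[OF E_hom] E_I E_pure I_closed comult_closed
          tens_closed embed_closed unit_closed null KC'.pure_tensor_closed)
  qed
qed

text \<open>Mirror image of the left law: the surviving cross term is c \<otimes> \<e>.\<close>

lemma comult'_counit_right: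
  assumes x: "x \<in> carrier C'"
  shows "tensor_map K C' (ground_space K) id fst (\<Delta>' x) = pure_tensor K C' (ground_space K) x \<one>\<^bsub>K\<^esub>"
proof -
  let ?E = "tensor_map K C' (ground_space K) id fst"
  interpret C'K: module_pair K C' "ground_space K"
    by (intro module_pairI C.ground_space_module C'.module_axioms)
  interpret KT: module K "tensor K C' (ground_space K)"
    by (rule C'K.tensor_module)
  have E_hom: "?E \<in> module_hom K T (tensor K C' (ground_space K))"
    by (intro tensor_map_hom C'.module_axioms C.ground_space_module fst_hom module_hom_id)
  have E_pure: "?E (y \<boxtimes> z) = pure_tensor K C' (ground_space K) y (fst z)"
    if "y \<in> carrier C'" "z \<in> carrier C'" for y z
    using tensor_map_pure[OF C'.module_axioms C'.module_axioms C'.module_axioms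
        C.ground_space_module module_hom_id fst_hom that] by simp
  have null: "pure_tensor K C' (ground_space K) y \<zero>\<^bsub>K\<^esub> = \<zero>\<^bsub>tensor K C' (ground_space K)\<^esub>"
    if "y \<in> carrier C'" for y
    using module_hom_zero[OF C.ground_space_module KT.module_axioms
        bilinear_on_right[OF C'K.pure_tensor_bilinear that]] by simp
  have E_I: "?E (I t) = \<zero>\<^bsub>tensor K C' (ground_space K)\<^esub>" if t: "t \<in> carrier CC" for t
    by (rule CC.tensor_hom_ext[OF module_hom_comp[OF I_hom E_hom]
          module_hom_zero_map[OF KT.module_axioms] KT.module_axioms _ t])
      (simp add: I_pure E_pure embed_closed null)
  have left_hom: "(\<lambda>x. pure_tensor K C' (ground_space K) x \<one>\<^bsub>K\<^esub>) \<in>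
      module_hom K C' (tensor K C' (ground_space K))"
    by (rule bilinear_on_left[OF C'K.pure_tensor_bilinear]) simp
  show ?thesis
  proof (rule augmented_hom_ext[OF module_hom_comp[OF comult'_hom E_hom] left_hom _ _ x])
    show "?E (\<Delta>' \<e>) = pure_tensor K C' (ground_space K) \<e> \<one>\<^bsub>K\<^esub>"
      by (simp add: comult'_unit E_pure unit_closed)
    fix c assume c: "c \<in> carrier C"
    show "?E (\<Delta>' (\<iota> c)) = pure_tensor K C' (ground_space K) (\<iota> c) \<one>\<^bsub>K\<^esub>"
      using c by (simp add: comult'_embed module_hom_add[OF E_hom] E_I E_pure I_closed comult_closed
          tens_closed embed_closed unit_closed null C'K.pure_tensor_closed)
  qed
qed

end

section \<open>The extended operator and the Rota-Baxter identity\<close>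

locale rota_baxter_augmentation = coalgebra_augmentation K C \<Delta> +
  rota_baxter_operator K C \<Delta> P "\<ominus>\<^bsub>K\<^esub> \<one>\<^bsub>K\<^esub>"
  for K :: "('k, 'r) ring_scheme" and C :: "('k, 'c) module"
    and \<Delta> :: "'c \<Rightarrow> ('c \<times> 'c \<Rightarrow> 'k) set" and P :: "'c \<Rightarrow> 'c" +
  assumes idem: "idempotent_operator C P"
begin

definition operator' ("P''") where "P' x = (fst x, P (snd x))"

lemma P_hom: "P \<in> module_hom K C C"
  using operator_linear by (simp add: linear_map_def mod_hom_def mod_hom_axioms_def)

lemma P_closed: "c \<in> carrier C \<Longrightarrow> P c \<in> carrier C"
  by (rule module_hom_mem[OF P_hom])

lemma P_idem: "c \<in> carrier C \<Longrightarrow> P (P c) = P c"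
  using idem by (simp add: idempotent_operator_def)

lemma P'_hom: "P' \<in> module_hom K C' C'"
  by (rule module_homI)
    (auto simp: operator'_def augmented_simps P_closed module_hom_add[OF P_hom] module_hom_smult[OF P_hom])

lemma P'_unit: "P' \<e> = \<e>"
  using module_hom_zero[OF C.module_axioms C.module_axioms P_hom] by (simp add: operator'_def)

lemma P'_embed: "P' (\<iota> c) = \<iota> (P c)"
  by (simp add: operator'_def)

text \<open>The maps \<open>P' \<otimes> P'\<close>, \<open>id \<otimes> P'\<close> and \<open>P' \<otimes> id\<close> are treated uniformly: \<open>f, g\<close> range over
  \<open>{id, P}\<close> and \<open>f', g'\<close> are their extensions fixing the group-like element.\<close>

lemma tensor_map_augmented:
  assumes f: "f \<in> module_hom K C C" and g: "g \<in> module_hom K C C"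
    and f': "f' \<in> module_hom K C' C'" and g': "g' \<in> module_hom K C' C'"
    and unit: "f' \<e> = \<e>" "g' \<e> = \<e>"
    and embed: "\<And>c. f' (\<iota> c) = \<iota> (f c)" "\<And>c. g' (\<iota> c) = \<iota> (g c)"
  shows "tensor_map K C' C' f' g' \<in> module_hom K T T"
    and "tensor_map K C' C' f' g' (\<Delta>' \<e>) = \<e> \<boxtimes> \<e>"
    and "c \<in> carrier C \<Longrightarrow> f c = a \<Longrightarrow> g c = b \<Longrightarrow> tensor_map K C' C' f' g' (\<Delta>' (\<iota> c)) =
      I (tensor_map K C C f g (\<Delta> c)) \<oplus>\<^bsub>T\<^esub> (\<e> \<boxtimes> \<iota> b \<oplus>\<^bsub>T\<^esub> \<iota> a \<boxtimes> \<e>)"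
proof -
  let ?M = "tensor_map K C' C' f' g'" and ?N = "tensor_map K C C f g"
  show hom: "?M \<in> module_hom K T T"
    by (intro tensor_map_hom C'.module_axioms f' g')
  have N_hom: "?N \<in> module_hom K CC CC"
    by (intro tensor_map_hom C.module_axioms f g)
  have pure: "?M (x \<boxtimes> y) = f' x \<boxtimes> g' y" if "x \<in> carrier C'" "y \<in> carrier C'" for x y
    by (intro tensor_map_pure C'.module_axioms f' g' that)
  have N_pure: "?N (pure_tensor K C C a b) = pure_tensor K C C (f a) (g b)"
    if "a \<in> carrier C" "b \<in> carrier C" for a b
    by (intro tensor_map_pure C.module_axioms f g that)
  have M_I: "?M (I t) = I (?N t)" if t: "t \<in> carrier CC" for t
    by (rule CC.tensor_hom_ext[OF module_hom_comp[OF I_hom hom]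
          module_hom_comp[OF N_hom I_hom] T.module_axioms _ t])
      (simp only: I_pure pure N_pure embed embed_closed module_hom_mem[OF f] module_hom_mem[OF g])
  show "?M (\<Delta>' \<e>) = \<e> \<boxtimes> \<e>"
    by (simp add: comult'_unit pure unit_closed unit)
  assume "c \<in> carrier C" "f c = a" "g c = b"
  then show "?M (\<Delta>' (\<iota> c)) = I (?N (\<Delta> c)) \<oplus>\<^bsub>T\<^esub> (\<e> \<boxtimes> \<iota> b \<oplus>\<^bsub>T\<^esub> \<iota> a \<boxtimes> \<e>)"
    by (simp add: comult'_embed module_hom_add[OF hom] M_I pure unit embed I_closed comult_closed
        tens_closed embed_closed unit_closed)
qed

lemma id_embed: "id (\<iota> c) = \<iota> (id c)"
  by simp

lemmas tensor_P'_P' = tensor_map_augmented[OF P_hom P_hom P'_hom P'_hom P'_unit P'_unit P'_embed P'_embed]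
  and tensor_id_P' = tensor_map_augmented[OF module_hom_id P_hom module_hom_id P'_hom
    id_apply P'_unit id_embed P'_embed]
  and tensor_P'_id = tensor_map_augmented[OF P_hom module_hom_id P'_hom module_hom_id
    P'_unit id_apply P'_embed id_embed]

text \<open>At \<open>\<iota> c\<close> the terms with \<e> form a single element \<open>w\<close>
  in each of the four tensors involved. On the right it occurs with coefficient 1 + 1 - 1 because
  the weight is minus one, which matches the single \<open>w\<close> on the left; what remains is
  the image under \<open>I\<close> of the identity in \<open>C\<close>.\<close>

lemma rota_baxter_augmented:
  assumes x: "x \<in> carrier C'"
  shows "tensor_map K C' C' P' P' (\<Delta>' x) =
    tensor_map K C' C' id P' (\<Delta>' (P' x)) \<oplus>\<^bsub>T\<^esub> tensor_map K C' C' P' id (\<Delta>' (P' x))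
      \<oplus>\<^bsub>T\<^esub> (\<ominus>\<^bsub>K\<^esub> \<one>\<^bsub>K\<^esub>) \<odot>\<^bsub>T\<^esub> \<Delta>' (P' x)" (is "?L x = ?R x")
proof (rule augmented_hom_ext[OF _ _ _ _ x])
  show "?L \<in> module_hom K C' T"
    by (rule module_hom_comp[OF comult'_hom tensor_P'_P'(1)])
  note h = module_hom_comp[OF P'_hom comult'_hom]
  show "?R \<in> module_hom K C' T"
    by (intro module_hom_sum module_hom_scale T.module_axioms weight_closed h
        module_hom_comp[OF h tensor_id_P'(1)] module_hom_comp[OF h tensor_P'_id(1)])
  have ee: "\<e> \<boxtimes> \<e> \<in> carrier T"
    by (intro tens_closed unit_closed)
  \<comment> \<open>Every map involved fixes \<e>, so the claim is that \<e> \<otimes> \<e> equals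
    twice itself minus itself.\<close>
  then show "?L \<e> = ?R \<e>"
    unfolding P'_unit tensor_P'_P'(2) tensor_id_P'(2) tensor_P'_id(2)
    unfolding comult'_unit
    by (simp add: T.smult_minus_1 T.M.a_assoc T.M.r_neg)
  fix c assume c: "c \<in> carrier C"
  define X where "X = I (tensor_map K C C id P (\<Delta> (P c)))"
  define Y where "Y = I (tensor_map K C C P id (\<Delta> (P c)))"
  define Z where "Z = I (\<Delta> (P c))"
  define w where "w = \<e> \<boxtimes> \<iota> (P c) \<oplus>\<^bsub>T\<^esub> \<iota> (P c) \<boxtimes> \<e>"
  have CC_closed: "tensor_map K C C id P (\<Delta> (P c)) \<in> carrier CC"
    "tensor_map K C C P id (\<Delta> (P c)) \<in> carrier CC" "\<Delta> (P c) \<in> carrier CC"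
    using c by (auto intro!: module_hom_mem[OF tensor_map_hom] C.module_axioms P_hom module_hom_id
        comult_closed P_closed)
  then have XYZ: "X \<in> carrier T" "Y \<in> carrier T" "Z \<in> carrier T"
    by (simp_all only: X_def Y_def Z_def I_closed)
  have w: "w \<in> carrier T"
    using c by (simp add: w_def tens_closed unit_closed embed_closed P_closed)
  have "?L (\<iota> c) = I (tensor_map K C C P P (\<Delta> c)) \<oplus>\<^bsub>T\<^esub> w"
    unfolding w_def by (rule tensor_P'_P'(3)[OF c refl refl])
  also have "I (tensor_map K C C P P (\<Delta> c)) = X \<oplus>\<^bsub>T\<^esub> Y \<oplus>\<^bsub>T\<^esub> (\<ominus>\<^bsub>K\<^esub> \<one>\<^bsub>K\<^esub>) \<odot>\<^bsub>T\<^esub> Z"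
    unfolding rota_baxter[OF c] X_def Y_def Z_def using CC_closed
    by (simp add: module_hom_add[OF I_hom] module_hom_smult[OF I_hom] CC.Q.quotient_space_module)
  finally have L: "?L (\<iota> c) = X \<oplus>\<^bsub>T\<^esub> Y \<oplus>\<^bsub>T\<^esub> (\<ominus>\<^bsub>T\<^esub> Z) \<oplus>\<^bsub>T\<^esub> w"
    using XYZ by (simp add: T.smult_minus_1)
  \<comment> \<open>Idempotence enters here. Evaluated at \<open>P c\<close>, the two mixed maps
    produce \<open>P (P c)\<close> in one cross term each; rewriting it to \<open>P c\<close> makes
    both of their contributions equal to \<open>w\<close>.\<close>
  have "?R (\<iota> c) = (X \<oplus>\<^bsub>T\<^esub> w) \<oplus>\<^bsub>T\<^esub> (Y \<oplus>\<^bsub>T\<^esub> w) \<oplus>\<^bsub>T\<^esub> (\<ominus>\<^bsub>K\<^esub> \<one>\<^bsub>K\<^esub>) \<odot>\<^bsub>T\<^esub> (Z \<oplus>\<^bsub>T\<^esub> w)"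
    unfolding P'_embed comult'_embed[OF P_closed[OF c], symmetric] X_def Y_def Z_def w_def
      tensor_id_P'(3)[OF P_closed[OF c] id_apply P_idem[OF c]]
      tensor_P'_id(3)[OF P_closed[OF c] P_idem[OF c] id_apply] ..
  also have "\<dots> = X \<oplus>\<^bsub>T\<^esub> Y \<oplus>\<^bsub>T\<^esub> (\<ominus>\<^bsub>T\<^esub> Z) \<oplus>\<^bsub>T\<^esub> w"
  proof -
    \<comment> \<open>Rewriting by associativity and commutativity does not cancel \<open>w\<close>
      against its negative; this equation supplies the cancellation as a rewrite rule.\<close>
    have "w \<oplus>\<^bsub>T\<^esub> (\<ominus>\<^bsub>T\<^esub> Z \<oplus>\<^bsub>T\<^esub> \<ominus>\<^bsub>T\<^esub> w) = \<ominus>\<^bsub>T\<^esub> Z"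
      using XYZ w by (simp add: T.M.a_comm[of "\<ominus>\<^bsub>T\<^esub> Z"] T.M.r_neg2)
    then show ?thesis
      using XYZ w by (simp add: T.smult_minus_1 T.M.minus_add T.M.a_ac)
  qed
  finally show "?L (\<iota> c) = ?R (\<iota> c)"
    using L by simp
qed

end

theorem proposition3p5:
  fixes K :: "('k, 'r) ring_scheme"
    and C :: "('k, 'c) module"
    and \<Delta> :: "'c \<Rightarrow> ('c \<times> 'c \<Rightarrow> 'k) set"
    and P :: "'c \<Rightarrow> 'c"
  assumes "field K" and "char_zero K"
    and "noncounitary_rota_baxter_coalgebra K C \<Delta> P (\<ominus>\<^bsub>K\<^esub> \<one>\<^bsub>K\<^esub>)"
    and "idempotent_operator C P"
  shows "\<exists>(C' :: ('k, 'k \<times> 'c) module) \<Delta>' \<epsilon> P' \<iota>.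
    rota_baxter_coalgebra K C' \<Delta>' \<epsilon> P' (\<ominus>\<^bsub>K\<^esub> \<one>\<^bsub>K\<^esub>) \<and>
    idempotent_operator C' P' \<and>
    linear_map K C C' \<iota> \<and> inj_on \<iota> (carrier C) \<and>
    \<iota> ` carrier C = mod_hom.ker C' (ground_space K) \<epsilon> \<and>
    (\<forall>c\<in>carrier C. P' (\<iota> c) = \<iota> (P c))"
proof -
  interpret aug: rota_baxter_augmentation K C \<Delta> P
    using assms(3,4)
    by (simp add: rota_baxter_augmentation_def rota_baxter_augmentation_axioms_def
        coalgebra_augmentation_def noncounitary_rota_baxter_coalgebra_def)
  let ?C = "augmented K C"
  \<comment> \<open>The facts above concern homomorphisms of modules, while
    \<open>linear_map\<close> asks for vector spaces; \<open>field K\<close> bridges the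
    two.\<close>
  have linear: "linear_map K V W f"
    if "module K V" "module K W" "f \<in> module_hom K V W"
    for V :: "('k, 'v) module" and W :: "('k, 'w) module" and f
    using that assms(1)
    by (simp add: linear_map_def vectorspace_def mod_hom_def mod_hom_axioms_def)
  have counit: "mod_hom K ?C (ground_space K) fst"
    by (rule mod_homI[OF aug.C'.module_axioms aug.C.ground_space_module aug.fst_hom])
  have "noncounitary_coalgebra K ?C aug.comult'"
    using aug.comult'_coassoc
    by (intro noncounitary_coalgebra.intro linear aug.C'.module_axioms aug.T.module_axioms
        aug.comult'_hom)
  moreover have "counitary_coalgebra_axioms K ?C aug.comult' fst"
    using aug.comult'_counit_left aug.comult'_counit_right
    by (intro counitary_coalgebra_axioms.intro linear aug.C'.module_axioms
        aug.C.ground_space_module aug.fst_hom)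
  moreover have "rota_baxter_operator K ?C aug.comult' aug.operator' (\<ominus>\<^bsub>K\<^esub> \<one>\<^bsub>K\<^esub>)"
    using aug.rota_baxter_augmented
    by (intro rota_baxter_operator.intro linear aug.C'.module_axioms aug.weight_closed aug.P'_hom)
  ultimately have "rota_baxter_coalgebra K ?C aug.comult' fst aug.operator' (\<ominus>\<^bsub>K\<^esub> \<one>\<^bsub>K\<^esub>)"
    by (intro rota_baxter_coalgebra.intro counitary_coalgebra.intro)
  moreover have "idempotent_operator ?C aug.operator'"
    by (auto simp: idempotent_operator_def aug.operator'_def augmented_simps aug.P_idem)
  moreover have "linear_map K C ?C aug.embed"
    by (intro linear aug.C.module_axioms aug.C'.module_axioms aug.embed_hom)
  moreover have "inj_on aug.embed (carrier C)"
    by (auto intro: inj_onI)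
  \<comment> \<open>The counit is the first projection, so its kernel consists exactly of the pairs
    with first component zero, and these are the embedded copies of elements of
    \<open>C\<close>.\<close>
  moreover have "aug.embed ` carrier C = mod_hom.ker ?C (ground_space K) fst"
    by (auto simp: mod_hom.ker_def[OF counit] augmented_simps)
  ultimately show ?thesis
    using aug.P'_embed by blast
qed

end
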